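(* Let $\Omega\subset\mathbb{R}^3$ be a domain, let $q:\Omega\to\mathbb{C}$, and let $f\in C^2(\Omega;\mathbb{C})$ be a nonvanishing solution of $(-\Delta+q)f=0$ in $\Omega$. Let $W\in C^1(\Omega;\mathbb{H}(\mathbb{C}))$ be a solution in $\Omega$ of $$VW:=DW-\frac{Df}{f}\,\overline{W}=0 .$$ Then the function $$\overset{\cdot}{W}:=\overline{V}W:=D_rW-\overline{W}\,\frac{Df}{f}$$ is a solution in $\Omega$ of the equation $$V_1w:=D_rw+\frac{Df}{f}\,w=0 .$$
   Context: $\mathbb{H}(\mathbb{C})$ is the algebra of complex quaternions $Q=\sum_{\alpha=0}^3Q_\alpha\mathbf{e}_\alpha$, $Q_\alpha\in\mathbb{C}$, where $\mathbf{e}_0=1$ and $\mathbf{e}_1,\mathbf{e}_2,\mathbf{e}_3$ are the standard quaternionic units ($\mathbf{e}_k^2=-1$, $\mathbf{e}_1\mathbf{e}_2=\mathbf{e}_3=-\mathbf{e}_2\mathbf{e}_1$ and cyclically); the complex imaginary unit $i$ commutes with all $\mathbf{e}_\alpha$. Write $Q=Q_0+\mathbf{Q}$ with scalar part $Q_0$ and vector part $\mathbf{Q}=\sum_{k=1}^3Q_k\mathbf{e}_k$; scalar functions are complex-valued. The quaternionic conjugate is $\overline{Q}=Q_0-\mathbf{Q}$ (complex conjugation is not applied). For a differentiable function $Q$ of $\mathbf{x}=(x_1,x_2,x_3)$, $DQ=\sum_{k=1}^3\mathbf{e}_k\,\partial_kQ$ and $D_rQ=\sum_{k=1}^3\partial_kQ\,\mathbf{e}_k$;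 for scalar $f$, $Df=D_rf=\nabla f$ viewed as a purely vectorial quaternion. $\Delta=\sum_{k=1}^3\partial_k^2$. The function $\overset{\cdot}{W}$ is called the (Bers) derivative of $W$. *)

theory Defs
  imports "HOL-Analysis.Analysis"
begin

section \<open>Complex quaternions\<close>

text \<open>A quaternion \<open>Q\<close> is the vector of its complex coordinates \<open>Q $ \<alpha>\<close> in the basis
  \<open>e\<^sub>0 = 1, e\<^sub>1, e\<^sub>2, e\<^sub>3\<close>. The index type \<open>4\<close> is the type of integers modulo four,
  so that its elements are \<open>0, 1, 2, 3\<close> (and the library's \<open>4 :: 4\<close> is \<open>0\<close>).
  The library product \<open>*\<close> on vectors is componentwise; quaternions are multiplied with \<open>\<odot>\<close>,
  and \<open>c *s Q\<close> is multiplication by the complex scalar \<open>c\<close>, which is central.\<close>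

type_synonym cquat = "complex ^ 4"

definition qunit :: "4 \<Rightarrow> cquat"
  where "qunit \<alpha> = axis \<alpha> 1"

definition qscalar :: "complex \<Rightarrow> cquat"
  where "qscalar c = c *s qunit 0"

definition qmult :: "cquat \<Rightarrow> cquat \<Rightarrow> cquat"  (infixl \<open>\<odot>\<close> 70)
  where "P \<odot> Q =
      (P $ 0 * Q $ 0 - P $ 1 * Q $ 1 - P $ 2 * Q $ 2 - P $ 3 * Q $ 3) *s qunit 0
    + (P $ 0 * Q $ 1 + P $ 1 * Q $ 0 + P $ 2 * Q $ 3 - P $ 3 * Q $ 2) *s qunit 1
    + (P $ 0 * Q $ 2 + P $ 2 * Q $ 0 + P $ 3 * Q $ 1 - P $ 1 * Q $ 3) *s qunit 2
    + (P $ 0 * Q $ 3 + P $ 3 * Q $ 0 + P $ 1 * Q $ 2 - P $ 2 * Q $ 1) *s qunit 3"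

definition qconj :: "cquat \<Rightarrow> cquat"
  where "qconj Q = (\<chi> \<alpha>. if \<alpha> = 0 then Q $ 0 else - (Q $ \<alpha>))"

lemma forall_index4: "(\<forall>\<alpha>::4. P \<alpha>) \<longleftrightarrow> P 0 \<and> P 1 \<and> P 2 \<and> P 3"
proof -
  have "(4::4) = 0" by simp
  then show ?thesis by (metis exhaust_4)
qed

lemma qmult_nth [simp]:
  "(P \<odot> Q) $ 0 = P $ 0 * Q $ 0 - P $ 1 * Q $ 1 - P $ 2 * Q $ 2 - P $ 3 * Q $ 3"
  "(P \<odot> Q) $ 1 = P $ 0 * Q $ 1 + P $ 1 * Q $ 0 + P $ 2 * Q $ 3 - P $ 3 * Q $ 2"
  "(P \<odot> Q) $ 2 = P $ 0 * Q $ 2 + P $ 2 * Q $ 0 + P $ 3 * Q $ 1 - P $ 1 * Q $ 3"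
  "(P \<odot> Q) $ 3 = P $ 0 * Q $ 3 + P $ 3 * Q $ 0 + P $ 1 * Q $ 2 - P $ 2 * Q $ 1"
  by (simp_all add: qmult_def qunit_def axis_def)

lemma qmult_units:
  "qunit 0 \<odot> Q = Q" "Q \<odot> qunit 0 = Q"
  "qunit 1 \<odot> qunit 1 = - qunit 0" "qunit 2 \<odot> qunit 2 = - qunit 0" "qunit 3 \<odot> qunit 3 = - qunit 0"
  "qunit 1 \<odot> qunit 2 = qunit 3" "qunit 2 \<odot> qunit 1 = - qunit 3"
  "qunit 2 \<odot> qunit 3 = qunit 1" "qunit 3 \<odot> qunit 2 = - qunit 1"
  "qunit 3 \<odot> qunit 1 = qunit 2" "qunit 1 \<odot> qunit 3 = - qunit 2"
  by (simp_all add: vec_eq_iff forall_index4) (simp_all add: qunit_def axis_def)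

lemma qmult_algebra:
  "(P \<odot> Q) \<odot> R = P \<odot> (Q \<odot> R)"
  "(P + Q) \<odot> R = P \<odot> R + Q \<odot> R" "P \<odot> (Q + R) = P \<odot> Q + P \<odot> R"
  "(c *s P) \<odot> Q = c *s (P \<odot> Q)" "P \<odot> (c *s Q) = c *s (P \<odot> Q)"
  by (simp_all add: vec_eq_iff forall_index4) (simp_all add: algebra_simps)

section \<open>Differential operators\<close>

definition partial :: "3 \<Rightarrow> (real ^ 3 \<Rightarrow> 'a::real_normed_vector) \<Rightarrow> real ^ 3 \<Rightarrow> 'a"
  where "partial k F x = vector_derivative (\<lambda>t. F (x + t *\<^sub>R axis k 1)) (at 0)"

text \<open>Membership in \<open>C\<^sup>n(\<Omega>)\<close>, for open \<open>\<Omega>\<close>. Requiring differentiability makes all the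
  partial derivatives genuine.\<close>

primrec C_k_on :: "nat \<Rightarrow> (real ^ 3 \<Rightarrow> 'a::real_normed_vector) \<Rightarrow> (real ^ 3) set \<Rightarrow> bool"
  where
    "C_k_on 0 F \<Omega> \<longleftrightarrow> continuous_on \<Omega> F"
  | "C_k_on (Suc n) F \<Omega> \<longleftrightarrow> (\<forall>x\<in>\<Omega>. F differentiable (at x)) \<and> (\<forall>k. C_k_on n (partial k F) \<Omega>)"

definition laplacian :: "(real ^ 3 \<Rightarrow> complex) \<Rightarrow> real ^ 3 \<Rightarrow> complex"
  where "laplacian f x = (\<Sum>k\<in>UNIV. partial k (partial k f) x)"

definition D_left :: "(real ^ 3 \<Rightarrow> cquat) \<Rightarrow> real ^ 3 \<Rightarrow> cquat"
  where "D_left Q x =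
    qunit 1 \<odot> partial 1 Q x + qunit 2 \<odot> partial 2 Q x + qunit 3 \<odot> partial 3 Q x"

definition D_right :: "(real ^ 3 \<Rightarrow> cquat) \<Rightarrow> real ^ 3 \<Rightarrow> cquat"
  where "D_right Q x =
    partial 1 Q x \<odot> qunit 1 + partial 2 Q x \<odot> qunit 2 + partial 3 Q x \<odot> qunit 3"

text \<open>\<open>Df / f\<close> for a complex-valued \<open>f\<close>.\<close>

definition log_D :: "(real ^ 3 \<Rightarrow> complex) \<Rightarrow> real ^ 3 \<Rightarrow> cquat"
  where "log_D f x = (1 / f x) *s D_left (\<lambda>y. qscalar (f y)) x"

definition V_op :: "(real ^ 3 \<Rightarrow> complex) \<Rightarrow> (real ^ 3 \<Rightarrow> cquat) \<Rightarrow> real ^ 3 \<Rightarrow> cquat"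
  where "V_op f W x = D_left W x - log_D f x \<odot> qconj (W x)"

text \<open>The Bers derivative of \<open>W\<close>; the operator usually written \<open>V\<close> with an overbar.\<close>

definition Bers_derivative :: "(real ^ 3 \<Rightarrow> complex) \<Rightarrow> (real ^ 3 \<Rightarrow> cquat) \<Rightarrow> real ^ 3 \<Rightarrow> cquat"
  where "Bers_derivative f W x = D_right W x - qconj (W x) \<odot> log_D f x"

definition V1_op :: "(real ^ 3 \<Rightarrow> complex) \<Rightarrow> (real ^ 3 \<Rightarrow> cquat) \<Rightarrow> real ^ 3 \<Rightarrow> cquat"
  where "V1_op f w x = D_right w x + log_D f x \<odot> w x"

text \<open>Classical solutions of the first-order equation \<open>L w = 0\<close> in \<open>\<Omega>\<close>. Differentiability is part
  of the notion: without it \<^const>\<open>partial\<close> may be an unspecified value.\<close>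

definition solves_on ::
    "((real ^ 3 \<Rightarrow> cquat) \<Rightarrow> real ^ 3 \<Rightarrow> cquat) \<Rightarrow> (real ^ 3 \<Rightarrow> cquat) \<Rightarrow> (real ^ 3) set \<Rightarrow> bool"
  where "solves_on L w \<Omega> \<longleftrightarrow> (\<forall>x\<in>\<Omega>. w differentiable (at x) \<and> L w x = 0)"

end

theory Submission
  imports Defs
begin

text \<open>Write \<open>w\<close> for the vector part of \<open>W\<close>, and put \<open>u = W\<^sub>0 / f\<close>. The equation \<open>V W = 0\<close> says
  \<open>div (f w) = 0\<close> and \<open>f\<^sup>2 \<nabla>u = - curl (f w)\<close>, and then the Bers derivative is the vector field \<open>2 f \<nabla>u\<close>.
  Formally \<open>div (f\<^sup>2 \<nabla>u) = 0\<close> and \<open>curl \<nabla>u = 0\<close> give the claim.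

  As \<open>W\<close> is only \<open>C\<^sup>1\<close>, the divergence equation holds weakly at first: \<open>\<Delta>u = h\<close> with
  \<open>h = - 2 (\<nabla>f / f) \<cdot> \<nabla>u\<close> merely continuous, and \<open>\<nabla>u\<close> has to be shown differentiable. Let \<open>m\<^sub>s\<close> be the
  mollification of \<open>\<nabla>u\<close> at scale \<open>s\<close> by \<open>\<phi> = div (k x)\<close>, where \<open>k(x) x\<close> is a regularised gradient of the
  Newton kernel. As \<open>\<phi>\<close> at scale \<open>s\<close> minus \<open>\<phi>\<close> at scale \<open>s/2\<close> is the divergence of a compactly supported
  gradient field \<open>P\<^sub>s\<close>, the difference \<open>m\<^sub>s - m\<^bsub>s/2\<^esub>\<close> equals \<open>P\<^sub>s * h\<close>. Boundedness of \<open>h\<close> makes \<open>m\<^sub>s - m\<^bsub>s/2\<^esub>\<close> of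
  order \<open>s\<close> with bounded derivatives, so \<open>\<nabla>u\<close>, and with it \<open>h\<close>, has a modulus of continuity
  \<open>t log (1/t)\<close>. Since the derivatives of \<open>P\<^sub>s\<close> have mean zero, the derivatives of
  \<open>m\<^sub>s - m\<^bsub>s/2\<^esub>\<close> are then dyadically summable, and \<open>\<nabla>u\<close> is differentiable.\<close>

section \<open>Partial derivatives and integration by parts\<close>

text \<open>The partials \<open>G\<close> are named data, so that calculus rules can return explicit
  formulas for them. The derivative is taken in the full space, so the notion passes to arbitrary
  subsets of \<open>S\<close>.\<close>

definition has_partials_on ::
    "(real ^ 3 \<Rightarrow> 'a::real_normed_vector) \<Rightarrow> (3 \<Rightarrow> real ^ 3 \<Rightarrow> 'a) \<Rightarrow> (real ^ 3) set \<Rightarrow> bool"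
  where "has_partials_on g G S \<longleftrightarrow>
    (\<forall>x\<in>S. (g has_derivative (\<lambda>v. \<Sum>i\<in>UNIV. (v $ i) *\<^sub>R G i x)) (at x)) \<and>
    (\<forall>i. continuous_on S (G i))"

lemma has_partials_on_subset: "has_partials_on g G S \<Longrightarrow> T \<subseteq> S \<Longrightarrow> has_partials_on g G T"
  unfolding has_partials_on_def by (meson continuous_on_subset subsetD)

lemma has_partials_on_derivative:
  "has_partials_on g G S \<Longrightarrow> x \<in> S \<Longrightarrow>
    (g has_derivative (\<lambda>v. \<Sum>i\<in>UNIV. (v $ i) *\<^sub>R G i x)) (at x)"
  by (simp add: has_partials_on_def)

lemma has_partials_on_continuous: "has_partials_on g G S \<Longrightarrow> continuous_on S g"
  unfolding has_partials_on_def
  by (meson continuous_at_imp_continuous_on has_derivative_continuous)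

lemma has_partials_on_continuous_partial: "has_partials_on g G S \<Longrightarrow> continuous_on S (G i)"
  unfolding has_partials_on_def by blast

text \<open>The factor \<open>c\<close> covers translation in both directions: \<open>c = 1\<close>
  and \<open>c = -1\<close> are the instances needed when differentiating under an integral.\<close>

lemma has_partials_on_line:
  fixes x :: "real ^ 3" and c t :: real
  assumes "has_partials_on g G S" "x + (c * t) *\<^sub>R axis i 1 \<in> S"
  shows "((\<lambda>t. g (x + (c * t) *\<^sub>R axis i 1)) has_vector_derivative c *\<^sub>R G i (x + (c * t) *\<^sub>R axis i 1)) (at t within U)"
proof -
  have "((\<lambda>t::real. x + (c * t) *\<^sub>R axis i 1) has_derivative (\<lambda>t. (c * t) *\<^sub>R axis i 1)) (at t within U)"
    by (auto intro!: derivative_eq_intros)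
  from has_derivative_compose[OF this has_partials_on_derivative[OF assms]]
  have "((\<lambda>t. g (x + (c * t) *\<^sub>R axis i 1)) has_derivative
      (\<lambda>s. \<Sum>k\<in>UNIV. (((c * s) *\<^sub>R axis i 1 :: real^3) $ k) *\<^sub>R G k (x + (c * t) *\<^sub>R axis i 1))) (at t within U)" .
  moreover have "(\<lambda>s. \<Sum>k\<in>UNIV. (((c * s) *\<^sub>R axis i 1 :: real^3) $ k) *\<^sub>R G k (x + (c * t) *\<^sub>R axis i 1))
      = (\<lambda>s. s *\<^sub>R (c *\<^sub>R G i (x + (c * t) *\<^sub>R axis i 1)))"
    by (simp add: axis_def if_distrib if_distribR sum.delta' mult.commute cong: if_cong)
  ultimately show ?thesis by (simp add: has_vector_derivative_def)
qed

lemma has_partials_on_mult: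
  fixes g h :: "real ^ 3 \<Rightarrow> 'a::real_normed_algebra"
  assumes "has_partials_on g G S" "has_partials_on h H S"
  shows "has_partials_on (\<lambda>x. g x * h x) (\<lambda>i x. g x * H i x + G i x * h x) S"
  unfolding has_partials_on_def
proof (intro conjI ballI allI)
  fix x assume x: "x \<in> S"
  show "((\<lambda>x. g x * h x) has_derivative
      (\<lambda>v. \<Sum>i\<in>UNIV. v $ i *\<^sub>R (g x * H i x + G i x * h x))) (at x)"
    by (rule has_derivative_eq_rhs[OF has_derivative_mult[OF has_partials_on_derivative[OF assms(1) x]
          has_partials_on_derivative[OF assms(2) x]]])
      (simp add: sum_3 algebra_simps)
next
  fix i show "continuous_on S (\<lambda>x. g x * H i x + G i x * h x)"
    by (intro continuous_intros has_partials_on_continuous[OF assms(1)] has_partials_on_continuous[OF assms(2)]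
       has_partials_on_continuous_partial[OF assms(1)] has_partials_on_continuous_partial[OF assms(2)])
qed

lemma has_partials_on_divide:
  fixes g h :: "real ^ 3 \<Rightarrow> complex"
  assumes "has_partials_on g G S" "has_partials_on h H S" "\<And>x. x \<in> S \<Longrightarrow> h x \<noteq> 0"
  shows "has_partials_on (\<lambda>x. g x / h x) (\<lambda>i x. G i x / h x - g x * H i x / (h x * h x)) S"
  unfolding has_partials_on_def
proof (intro conjI ballI allI)
  fix x assume x: "x \<in> S"
  note nz = assms(3)[OF x]
  have e: "G i x / h x - g x * H i x / (h x * h x) = (G i x * h x - g x * H i x) / (h x * h x)" for i
    using nz by (simp add: field_simps)
  show "((\<lambda>x. g x / h x) has_derivative
      (\<lambda>v. \<Sum>i\<in>UNIV. v $ i *\<^sub>R (G i x / h x - g x * H i x / (h x * h x)))) (at x)"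
    by (rule has_derivative_eq_rhs[OF has_derivative_divide'[OF has_partials_on_derivative[OF assms(1) x]
          has_partials_on_derivative[OF assms(2) x] nz]])
      (simp add: e sum_3 scaleR_conv_of_real algebra_simps diff_divide_distrib add_divide_distrib)
next
  fix i show "continuous_on S (\<lambda>x. G i x / h x - g x * H i x / (h x * h x))"
    by (intro continuous_intros has_partials_on_continuous[OF assms(1)] has_partials_on_continuous[OF assms(2)]
       has_partials_on_continuous_partial[OF assms(1)] has_partials_on_continuous_partial[OF assms(2)])
      (use assms(3) in auto)
qed

lemma has_partials_on_shift:
  assumes "has_partials_on g G S" "\<And>x. x \<in> T \<Longrightarrow> x + c \<in> S"
  shows "has_partials_on (\<lambda>x. g (x + c)) (\<lambda>i x. G i (x + c)) T"
  unfolding has_partials_on_def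
proof (intro conjI ballI allI)
  fix x assume x: "x \<in> T"
  have "((\<lambda>x. x + c) has_derivative (\<lambda>v. v)) (at x)"
    by (auto intro!: derivative_eq_intros)
  from has_derivative_compose[OF this has_partials_on_derivative[OF assms(1) assms(2)[OF x]]]
  show "((\<lambda>x. g (x + c)) has_derivative (\<lambda>v. \<Sum>i\<in>UNIV. v $ i *\<^sub>R G i (x + c))) (at x)" .
next
  fix i show "continuous_on T (\<lambda>x. G i (x + c))"
    by (rule continuous_on_compose2[OF has_partials_on_continuous_partial[OF assms(1), of i]])
      (auto intro!: continuous_intros assms(2))
qed

text \<open>Translating the integrand translates the box. As \<open>K\<close> lies in the old box
  and in the translated one, both integrals reduce to integrals over \<open>K\<close>.\<close>

lemma integral_shift_support:
  fixes m :: "'a::euclidean_space \<Rightarrow> 'b::banach"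
  assumes z: "\<And>y. y \<notin> K \<Longrightarrow> m y = 0" and K: "K \<subseteq> cbox a b" and Kc: "\<And>y. y \<in> K \<Longrightarrow> y - c \<in> cbox a b"
  shows "integral (cbox a b) (\<lambda>y. m (y + c)) = integral (cbox a b) m"
proof -
  have r: "integral T m = integral (K \<inter> T) m" for T
  proof -
    have "(\<lambda>x. if x \<in> K then m x else 0) = m" using z by auto
    then show ?thesis using integral_restrict_Int[of T K m] by simp
  qed
  have "integral (cbox a b) (\<lambda>y. m (y + c)) = integral (cbox (a + c) (b + c)) m"
    using integral_shift_cbox[of "a + c" c "b + c" m] by simp
  moreover have "K \<subseteq> cbox (a + c) (b + c)"
  proof
    fix y assume "y \<in> K"
    then show "y \<in> cbox (a + c) (b + c)" using Kc[of y] by (simp add: mem_box algebra_simps)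
  qed
  ultimately show ?thesis using r[of "cbox (a + c) (b + c)"] r[of "cbox a b"] K by (simp add: Int_absorb2)
qed

lemma compact_in_open_margin:
  fixes K :: "'a::euclidean_space set"
  assumes "compact K" "open S" "K \<subseteq> S"
  obtains d where "d > 0" "\<And>x v. x \<in> K \<Longrightarrow> norm v < d \<Longrightarrow> x + v \<in> S"
proof -
  from compact_subset_open_imp_ball_epsilon_subset[OF assms] obtain d where
    d: "d > 0" "(\<Union>x\<in>K. ball x d) \<subseteq> S" .
  show ?thesis
  proof
    show "d > 0" by fact
    fix x v :: 'a assume "x \<in> K" "norm v < d"
    then have "x + v \<in> ball x d" by (simp add: dist_norm)
    then show "x + v \<in> S" using d \<open>x \<in> K\<close> by blast
  qed
qed

text \<open>The integral of the translate of \<open>g\<close> along axis \<open>i\<close> is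
  constant for small \<open>t\<close>, because the support stays in the box. Differentiating under
  the integral at \<open>t = 0\<close> gives the claim.\<close>

lemma integral_partial_eq_0:
  fixes g :: "real ^ 3 \<Rightarrow> 'b::banach"
  assumes S: "open S" "cbox a b \<subseteq> S" and g: "has_partials_on g G S"
    and K: "compact K" "K \<subseteq> box a b" "\<And>y. y \<notin> K \<Longrightarrow> g y = 0"
  shows "integral (cbox a b) (G i) = 0"
proof -
  obtain d1 where d1: "d1 > 0" "\<And>x v. x \<in> cbox a b \<Longrightarrow> norm v < d1 \<Longrightarrow> x + v \<in> S"
    using compact_in_open_margin[OF compact_cbox S] by metis
  obtain d2 where d2: "d2 > 0" "\<And>x v. x \<in> K \<Longrightarrow> norm v < d2 \<Longrightarrow> x + v \<in> box a b"
    using compact_in_open_margin[OF K(1) open_box K(2)] by metis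
  \<comment> \<open>For shifts shorter than \<open>d\<close> the box stays inside \<open>S\<close>
    and the support stays inside the box.\<close>
  define d where "d = min d1 d2"
  have d: "d > 0" using d1 d2 by (simp add: d_def)
  define U where "U = {-d<..<d}"
  have inS: "y + t *\<^sub>R axis i 1 \<in> S" if "t \<in> U" "y \<in> cbox a b" for t y
    using d1(2)[of y "t *\<^sub>R axis i 1"] that by (auto simp: U_def d_def)
  have cS: "continuous_on S g" "continuous_on S (G i)"
    using g by (auto intro: has_partials_on_continuous has_partials_on_continuous_partial)
  have "((\<lambda>t. integral (cbox a b) (\<lambda>y. g (y + t *\<^sub>R axis i 1))) has_vector_derivative
      integral (cbox a b) (\<lambda>y. G i (y + 0 *\<^sub>R axis i 1))) (at 0 within U)"
  proof (rule leibniz_rule_vector_derivative[where fx = "\<lambda>t y. G i (y + t *\<^sub>R axis i 1)"])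
    show "0 \<in> U" "convex U" using d by (auto simp: U_def)
    show "((\<lambda>t. g (y + t *\<^sub>R axis i 1)) has_vector_derivative G i (y + t *\<^sub>R axis i 1)) (at t within U)"
      if "t \<in> U" "y \<in> cbox a b" for t y
      using has_partials_on_line[OF g, of y 1 t i U] inS[OF that] by simp
    show "(\<lambda>y. g (y + t *\<^sub>R axis i 1)) integrable_on cbox a b" if "t \<in> U" for t
      by (intro integrable_continuous continuous_on_compose2[OF cS(1)])
        (auto intro!: continuous_intros inS that)
    show "continuous_on (U \<times> cbox a b) (\<lambda>(t, y). G i (y + t *\<^sub>R axis i 1))"
      unfolding split_beta
      by (rule continuous_on_compose2[OF cS(2)]) (auto intro!: continuous_intros inS)
  qed
  moreover have "((\<lambda>t. integral (cbox a b) (\<lambda>y. g (y + t *\<^sub>R axis i 1))) has_vector_derivative 0) (at 0 within U)"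
  proof (rule has_vector_derivative_transform[OF _ _ has_vector_derivative_const])
    show "0 \<in> U" using d by (auto simp: U_def)
    fix t assume t: "t \<in> U"
    show "integral (cbox a b) (\<lambda>y. g (y + t *\<^sub>R axis i 1)) = integral (cbox a b) g"
    proof (rule integral_shift_support)
      show "y \<notin> K \<Longrightarrow> g y = 0" for y by fact
      show "K \<subseteq> cbox a b" using K(2) box_subset_cbox by blast
      fix y assume "y \<in> K"
      then show "y - t *\<^sub>R axis i 1 \<in> cbox a b"
        using d2(2)[of y "- (t *\<^sub>R axis i 1)"] t box_subset_cbox[of a b]
        by (force simp: U_def d_def)
    qed
  qed
  moreover have "at 0 within U = at (0::real)"
    using d by (intro at_within_open) (auto simp: U_def)
  ultimately show ?thesis
    using vector_derivative_unique_at[of _ "integral (cbox a b) (\<lambda>y. G i (y + 0 *\<^sub>R axis i 1))" 0 0] by simp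
qed

text \<open>Both sides are minus the derivative at \<open>t = 0\<close> of \<open>\<integral> v(y) \<partial>\<^sub>i\<eta>(y + t e\<^sub>k) dy\<close>: shift \<open>t\<close> onto \<open>v\<close>, or integrate
  by parts first. Thus no second derivatives of \<open>v\<close> or \<open>\<eta>\<close> are needed.\<close>

lemma integral_partials_swap:
  fixes v \<eta> :: "real ^ 3 \<Rightarrow> complex"
  assumes S: "open S" "cbox a b \<subseteq> S" and v: "has_partials_on v V S" and e: "has_partials_on \<eta> H S"
    and K: "compact K" "K \<subseteq> box a b" "\<And>y. y \<notin> K \<Longrightarrow> \<eta> y = 0" "\<And>i y. y \<notin> K \<Longrightarrow> H i y = 0"
  shows "integral (cbox a b) (\<lambda>y. V i y * H k y) = integral (cbox a b) (\<lambda>y. V k y * H i y)"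
proof -
  let ?B = "cbox a b" and ?e = "axis k 1 :: real ^ 3"
  obtain d1 where d1: "d1 > 0" "\<And>x v. x \<in> cbox a b \<Longrightarrow> norm v < d1 \<Longrightarrow> x + v \<in> S"
    using compact_in_open_margin[OF compact_cbox S] by metis
  obtain d2 where d2: "d2 > 0" "\<And>x v. x \<in> K \<Longrightarrow> norm v < d2 \<Longrightarrow> x + v \<in> box a b"
    using compact_in_open_margin[OF K(1) open_box K(2)] by metis
  define d where "d = min d1 d2"
  have d: "d > 0" using d1 d2 by (simp add: d_def)
  define U where "U = {-d<..<d}"
  have U: "0 \<in> U" "convex U" using d by (auto simp: U_def)
  have inS: "y + t *\<^sub>R ?e \<in> S" if "t \<in> U" "y \<in> ?B" for t y
    using d1(2)[of y "t *\<^sub>R ?e"] that by (auto simp: U_def d_def)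
  have inS': "y - t *\<^sub>R ?e \<in> S" if "t \<in> U" "y \<in> ?B" for t y
    using inS[of "-t" y] that by (auto simp: U_def)
  have inB: "y - t *\<^sub>R ?e \<in> box a b" if "t \<in> U" "y \<in> K" for t y
    using d2(2)[of y "- (t *\<^sub>R ?e)"] that by (auto simp: U_def d_def)
  have c: "continuous_on S v" "continuous_on S \<eta>" "continuous_on S (V i)" "continuous_on S (H i)" for i
    using v e by (auto intro: has_partials_on_continuous has_partials_on_continuous_partial)
  have cB: "continuous_on ?B v" "continuous_on ?B \<eta>" "continuous_on ?B (V i)" "continuous_on ?B (H i)" for i
    using c S(2) by (auto intro: continuous_on_subset)
  have sh: "continuous_on ?B (\<lambda>y. w (y + t *\<^sub>R ?e))" "continuous_on ?B (\<lambda>y. w (y - t *\<^sub>R ?e))"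
    if "continuous_on S w" "t \<in> U" for t and w :: "real ^ 3 \<Rightarrow> complex"
    using inS inS' that(2)
    by (auto intro!: continuous_intros continuous_on_compose2[OF that(1), of _ "\<lambda>y. y + t *\<^sub>R ?e"]
        continuous_on_compose2[OF that(1), of _ "\<lambda>y. y - t *\<^sub>R ?e"])
  have sh2: "continuous_on (U \<times> ?B) (\<lambda>p. w (snd p + fst p *\<^sub>R ?e))"
    "continuous_on (U \<times> ?B) (\<lambda>p. w (snd p - fst p *\<^sub>R ?e))" "continuous_on (U \<times> ?B) (\<lambda>p. w (snd p))"
    if "continuous_on S w" for w :: "real ^ 3 \<Rightarrow> complex"
    using inS inS' S(2)
    by (auto intro!: continuous_intros continuous_on_compose2[OF that, of _ "\<lambda>p. snd p + fst p *\<^sub>R ?e"]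
        continuous_on_compose2[OF that, of _ "\<lambda>p. snd p - fst p *\<^sub>R ?e"] continuous_on_compose2[OF that, of _ snd])
  define T where "T t = integral ?B (\<lambda>y. v y * H i (y + t *\<^sub>R ?e))" for t
  \<comment> \<open>The shift can be moved onto \<open>v\<close> because \<open>H i\<close> vanishes
    off \<open>K\<close>, and \<open>K\<close> shifted by \<open>t\<close> is still in the
    box.\<close>
  have T1: "T t = integral ?B (\<lambda>y. v (y - t *\<^sub>R ?e) * H i y)" if t: "t \<in> U" for t
  proof -
    have "integral ?B (\<lambda>y. (\<lambda>y. v (y - t *\<^sub>R ?e) * H i y) (y + t *\<^sub>R ?e)) = integral ?B (\<lambda>y. v (y - t *\<^sub>R ?e) * H i y)"
      using K(2) box_subset_cbox[of a b] inB[OF t] K(4)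
      by (intro integral_shift_support[of K]) auto
    then show ?thesis by (simp add: T_def)
  qed
  have T2: "T t = integral ?B (\<lambda>y. - (V i y * \<eta> (y + t *\<^sub>R ?e)))" if t: "t \<in> U" for t
  proof -
    \<comment> \<open>An open neighbourhood of the box on which both \<open>v\<close> and the
      translate of \<open>\<eta>\<close> have partials, as the integration by parts
      requires.\<close>
    define S' where "S' = S \<inter> (\<lambda>y. y + t *\<^sub>R ?e) -` S"
    have S': "open S'" unfolding S'_def
      by (intro open_Int S(1) open_vimage continuous_intros)
    have BS': "?B \<subseteq> S'" using S(2) inS[OF t] by (auto simp: S'_def)
    have esh: "has_partials_on (\<lambda>y. \<eta> (y + t *\<^sub>R ?e)) (\<lambda>j y. H j (y + t *\<^sub>R ?e)) S'"
      by (rule has_partials_on_shift[OF e]) (auto simp: S'_def)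
    have vS: "has_partials_on v V S'" by (rule has_partials_on_subset[OF v]) (auto simp: S'_def)
    have "integral ?B (\<lambda>y. v y * H i (y + t *\<^sub>R ?e) + V i y * \<eta> (y + t *\<^sub>R ?e)) = 0"
    proof (rule integral_partial_eq_0[OF S' BS' has_partials_on_mult[OF vS esh], of "(\<lambda>y. y - t *\<^sub>R ?e) ` K"])
      show "compact ((\<lambda>y. y - t *\<^sub>R ?e) ` K)"
        by (intro compact_continuous_image continuous_intros K(1))
      show "(\<lambda>y. y - t *\<^sub>R ?e) ` K \<subseteq> box a b" using inB[OF t] by auto
      fix y assume "y \<notin> (\<lambda>y. y - t *\<^sub>R ?e) ` K"
      then have "y + t *\<^sub>R ?e \<notin> K" by (metis add_diff_cancel_right' image_eqI)
      then show "v y * \<eta> (y + t *\<^sub>R ?e) = 0" using K(3) by simp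
    qed
    moreover have "(\<lambda>y. v y * H i (y + t *\<^sub>R ?e)) integrable_on ?B"
      by (intro integrable_continuous continuous_on_mult cB sh c t)
    moreover have "(\<lambda>y. V i y * \<eta> (y + t *\<^sub>R ?e)) integrable_on ?B"
      by (intro integrable_continuous continuous_on_mult cB sh c t)
    ultimately show ?thesis
      unfolding T_def by (subst (asm) integral_add) (auto simp: add_eq_0_iff2)
  qed
  have "((\<lambda>t. integral ?B (\<lambda>y. v (y - t *\<^sub>R ?e) * H i y)) has_vector_derivative
      integral ?B (\<lambda>y. - V k (y - 0 *\<^sub>R ?e) * H i y)) (at 0 within U)"
  proof (rule leibniz_rule_vector_derivative[OF _ _ _ U, where fx = "\<lambda>t y. - V k (y - t *\<^sub>R ?e) * H i y"])
    show "((\<lambda>t. v (y - t *\<^sub>R ?e) * H i y) has_vector_derivative - V k (y - t *\<^sub>R ?e) * H i y) (at t within U)"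
      if "t \<in> U" "y \<in> ?B" for t y
    proof -
      have "((\<lambda>t. v (y - t *\<^sub>R ?e)) has_vector_derivative - V k (y - t *\<^sub>R ?e)) (at t within U)"
        using has_partials_on_line[OF v, of y "-1" t k U] inS'[OF that] by simp
      then show ?thesis by (rule has_vector_derivative_mult_left)
    qed
    show "(\<lambda>y. v (y - t *\<^sub>R ?e) * H i y) integrable_on ?B" if "t \<in> U" for t
      by (intro integrable_continuous continuous_on_mult continuous_on_minus cB sh c that)
    show "continuous_on (U \<times> ?B) (\<lambda>(t, y). - V k (y - t *\<^sub>R ?e) * H i y)"
      unfolding split_beta
      by (intro continuous_on_mult continuous_on_minus sh2 c)
  qed
  then have D1: "(T has_vector_derivative integral ?B (\<lambda>y. - (V k y * H i y))) (at 0 within U)"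
    by (intro has_vector_derivative_transform[OF U(1) T1]) simp_all
  have "((\<lambda>t. integral ?B (\<lambda>y. - (V i y * \<eta> (y + t *\<^sub>R ?e)))) has_vector_derivative
      integral ?B (\<lambda>y. - (V i y * H k (y + 0 *\<^sub>R ?e)))) (at 0 within U)"
  proof (rule leibniz_rule_vector_derivative[OF _ _ _ U, where fx = "\<lambda>t y. - (V i y * H k (y + t *\<^sub>R ?e))"])
    show "((\<lambda>t. - (V i y * \<eta> (y + t *\<^sub>R ?e))) has_vector_derivative - (V i y * H k (y + t *\<^sub>R ?e))) (at t within U)"
      if "t \<in> U" "y \<in> ?B" for t y
    proof -
      have "((\<lambda>t. \<eta> (y + t *\<^sub>R ?e)) has_vector_derivative H k (y + t *\<^sub>R ?e)) (at t within U)"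
        using has_partials_on_line[OF e, of y 1 t k U] inS[OF that] by simp
      then show ?thesis by (intro has_vector_derivative_minus has_vector_derivative_mult_right)
    qed
    show "(\<lambda>y. - (V i y * \<eta> (y + t *\<^sub>R ?e))) integrable_on ?B" if "t \<in> U" for t
      by (intro integrable_continuous continuous_on_mult continuous_on_minus cB sh c that)
    show "continuous_on (U \<times> ?B) (\<lambda>(t, y). - (V i y * H k (y + t *\<^sub>R ?e)))"
      unfolding split_beta
      by (intro continuous_on_mult continuous_on_minus sh2 c)
  qed
  then have D2: "(T has_vector_derivative integral ?B (\<lambda>y. - (V i y * H k y))) (at 0 within U)"
    by (intro has_vector_derivative_transform[OF U(1) T2]) simp_all
  have at0: "at 0 within U = at (0::real)" using d by (intro at_within_open) (auto simp: U_def)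
  have "integral ?B (\<lambda>y. - (V i y * H k y)) = integral ?B (\<lambda>y. - (V k y * H i y))"
    using vector_derivative_unique_at[of T _ 0, OF D2[unfolded at0] D1[unfolded at0]] .
  then show ?thesis by simp
qed

section \<open>A dyadic decomposition of the Newton kernel\<close>

text \<open>\<open>x \<mapsto> newton_profile (x \<bullet> x) *\<^sub>R x\<close> is minus the gradient of \<open>1 / |x|\<close> outside the unit ball; inside, \<open>t powr (-3/2)\<close>
  is replaced by its Taylor polynomial of degree 2 at \<open>t = 1\<close>.\<close>

definition newton_profile :: "real \<Rightarrow> real"
  where "newton_profile t = (if t \<le> 1 then (35 - 42 * t + 15 * t\<^sup>2) / 8 else t powr (-3/2))"

definition newton_profile' :: "real \<Rightarrow> real"
  where "newton_profile' t = (if t \<le> 1 then (30 * t - 42) / 8 else - (3/2) * t powr (-5/2))"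

text \<open>The branches meet only at \<open>t = 1\<close>, where the values \<open>1\<close> and
  the slopes \<open>-3/2\<close> agree. The second derivatives agree there as well, which makes the
  divergence in \<open>bump_profile_eq\<close> continuously differentiable.\<close>

lemma newton_profile_deriv:
  "(newton_profile has_real_derivative newton_profile' t) (at t within A)"
proof -
  have "((\<lambda>t. if t \<in> {..1} then (35 - 42 * t + 15 * t\<^sup>2) / 8 else t powr (-3/2)) has_vector_derivative
     (if t \<in> {..1} then (30 * t - 42) / 8 else - (3/2) * t powr (-5/2))) (at t within UNIV)"
  proof (rule has_vector_derivative_If_within_closures[of t "{..1}" "{1..}"])
    have "((\<lambda>t::real. (35 - 42 * t + 15 * t\<^sup>2) / 8) has_real_derivative (30 * t - 42) / 8) (at t within X)" for X
      by (auto intro!: derivative_eq_intros)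
    then show "((\<lambda>t. (35 - 42 * t + 15 * t\<^sup>2) / 8) has_vector_derivative (30 * t - 42) / 8)
       (at t within {..1} \<union> closure {..1} \<inter> closure {1..})"
      by (simp add: has_real_derivative_iff_has_vector_derivative)
    assume "t \<in> {1..} \<union> closure {..1} \<inter> closure {1..}"
    then have "t \<ge> 1" by auto
    then have "((\<lambda>t::real. t powr (-3/2)) has_real_derivative - (3/2) * t powr (-5/2)) (at t)"
      using has_real_derivative_powr[of t "-3/2"] by simp
    then have "((\<lambda>t::real. t powr (-3/2)) has_real_derivative - (3/2) * t powr (-5/2)) (at t within X)" for X
      by (rule has_field_derivative_at_within)
    then show "((\<lambda>t. t powr (-3/2)) has_vector_derivative - (3/2) * t powr (-5/2))
       (at t within {1..} \<union> closure {..1} \<inter> closure {1..})"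
      by (simp add: has_real_derivative_iff_has_vector_derivative)
  qed auto
  then have "(newton_profile has_real_derivative newton_profile' t) (at t)"
    unfolding newton_profile_def[abs_def] newton_profile'_def
    by (simp add: has_real_derivative_iff_has_vector_derivative)
  then show ?thesis by (rule has_field_derivative_at_within)
qed

lemma continuous_on_newton_profile': "continuous_on A newton_profile'"
proof -
  have "continuous_on ({..1} \<union> {1..}) (\<lambda>t::real. if t \<le> 1 then (30 * t - 42) / 8 else - (3/2) * t powr (-5/2))"
    by (rule continuous_on_If) (auto intro!: continuous_intros)
  moreover have "{..1} \<union> {1..} = (UNIV :: real set)" by auto
  ultimately show ?thesis
    unfolding newton_profile'_def[abs_def] using continuous_on_subset[of UNIV _ A] by simp
qed

text \<open>The square makes the bump continuously differentiable across the unit sphere. The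
  constant is the one produced by the Taylor polynomial; the total mass is left
  unnormalised.\<close>

definition bump_profile :: "real \<Rightarrow> real"
  where "bump_profile t = 105 / 8 * (max 0 (1 - t))\<^sup>2"

text \<open>The left-hand side is the divergence of \<open>newton_profile (x \<bullet> x) *\<^sub>R x\<close> at \<open>t = x \<bullet> x\<close>.\<close>

lemma bump_profile_eq:
  "3 * newton_profile t + 2 * t * newton_profile' t = bump_profile t"
proof (cases "t \<le> 1")
  case True
  then show ?thesis
    by (simp add: newton_profile_def newton_profile'_def bump_profile_def max_def power2_eq_square field_simps)
next
  case False
  then have "t * t powr (-5/2) = t powr (-3/2)"
    using powr_mult_base[of t "-5/2"] by simp
  then show ?thesis
    using False by (simp add: newton_profile_def newton_profile'_def bump_profile_def max_def)
qed

lemma bump_profile_deriv: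
  "(bump_profile has_real_derivative - (105 / 4) * max 0 (1 - t)) (at t within A)"
proof -
  have "((\<lambda>t. if t \<in> {..1} then 105 / 8 * (1 - t)\<^sup>2 else 0) has_vector_derivative
     (if t \<in> {..1} then - (105 / 4) * (1 - t) else 0)) (at t within UNIV)"
  proof (rule has_vector_derivative_If_within_closures[of t "{..1}" "{1..}"])
    have "((\<lambda>t::real. 105 / 8 * (1 - t)\<^sup>2) has_real_derivative - (105 / 4) * (1 - t)) (at t within X)" for X
      by (auto intro!: derivative_eq_intros simp: field_simps)
    then show "((\<lambda>t. 105 / 8 * (1 - t)\<^sup>2) has_vector_derivative - (105 / 4) * (1 - t))
       (at t within {..1} \<union> closure {..1} \<inter> closure {1..})"
      by (simp add: has_real_derivative_iff_has_vector_derivative)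
  qed auto
  moreover have "(\<lambda>t. if t \<in> {..1} then 105 / 8 * (1 - t)\<^sup>2 else 0) = bump_profile"
    by (auto simp: bump_profile_def fun_eq_iff max_def)
  moreover have "(if t \<in> {..1} then - (105 / 4) * (1 - t) else 0) = - (105 / 4) * max 0 (1 - t)"
    by (auto simp: max_def)
  ultimately have "(bump_profile has_real_derivative - (105 / 4) * max 0 (1 - t)) (at t)"
    by (simp add: has_real_derivative_iff_has_vector_derivative)
  then show ?thesis by (rule has_field_derivative_at_within)
qed

text \<open>If \<open>X z\<close> is the field with profile \<open>newton_profile\<close>, this is
  the profile of \<open>X z - 4 X (2 z)\<close>. The Newton field is homogeneous of degree -2, so
  the two terms cancel outside the unit ball.\<close>

definition dyadic_profile :: "real \<Rightarrow> real"
  where "dyadic_profile t = newton_profile t - 8 * newton_profile (4 * t)"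

definition dyadic_profile' :: "real \<Rightarrow> real"
  where "dyadic_profile' t = newton_profile' t - 32 * newton_profile' (4 * t)"

lemma dyadic_profile_deriv:
  "(dyadic_profile has_real_derivative dyadic_profile' t) (at t within A)"
  unfolding dyadic_profile_def[abs_def] dyadic_profile'_def
  by (auto intro!: derivative_eq_intros DERIV_chain2[OF newton_profile_deriv] newton_profile_deriv)

lemma continuous_on_dyadic_profile': "continuous_on A dyadic_profile'"
  unfolding dyadic_profile'_def[abs_def]
  by (intro continuous_on_diff continuous_on_mult_left continuous_on_newton_profile'
      continuous_on_compose2[OF continuous_on_newton_profile'[of UNIV], of A "\<lambda>t. 4 * t"])
    (auto intro!: continuous_intros)

lemma four_powr: "(4::real) powr (-3/2) = 1/8" "(4::real) powr (-5/2) = 1/32"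
proof -
  have "(4::real) powr (-3/2) = (2 powr 2) powr (-3/2)" by simp
  also have "\<dots> = 2 powr (-3)" unfolding powr_powr by simp
  also have "\<dots> = 1/8" by (simp add: powr_minus_divide)
  finally show "(4::real) powr (-3/2) = 1/8" .
  have "(4::real) powr (-5/2) = (2 powr 2) powr (-5/2)" by simp
  also have "\<dots> = 2 powr (-5)" unfolding powr_powr by simp
  also have "\<dots> = 1/32" by (simp add: powr_minus_divide)
  finally show "(4::real) powr (-5/2) = 1/32" .
qed

lemma newton_profile_ge_1:
  "t \<ge> 1 \<Longrightarrow> newton_profile t = t powr (-3/2)" "t \<ge> 1 \<Longrightarrow> newton_profile' t = - (3/2) * t powr (-5/2)"
  by (cases "t = 1"; simp add: newton_profile_def newton_profile'_def)+

lemma dyadic_profile_eq_0: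
  assumes "t \<ge> 1" shows "dyadic_profile t = 0" "dyadic_profile' t = 0"
  using assms four_powr
  by (simp_all add: dyadic_profile_def dyadic_profile'_def newton_profile_ge_1 powr_mult)

section \<open>The mollifier and the dyadic gradient field as functions on space\<close>

definition bump :: "real ^ 3 \<Rightarrow> real"
  where "bump z = bump_profile (z \<bullet> z)"

definition bump_partial :: "3 \<Rightarrow> real ^ 3 \<Rightarrow> real"
  where "bump_partial i z = 2 * (- (105 / 4) * max 0 (1 - z \<bullet> z)) * z $ i"

definition dyadic_field :: "3 \<Rightarrow> real ^ 3 \<Rightarrow> real"
  where "dyadic_field j z = dyadic_profile (z \<bullet> z) * z $ j"

definition dyadic_field_partial :: "3 \<Rightarrow> 3 \<Rightarrow> real ^ 3 \<Rightarrow> real"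
  where "dyadic_field_partial j i z =
    2 * dyadic_profile' (z \<bullet> z) * z $ i * z $ j + (if i = j then dyadic_profile (z \<bullet> z) else 0)"

lemma has_partials_on_radial:
  assumes "\<And>t. (h has_real_derivative h' t) (at t)" "continuous_on UNIV h'"
  shows "has_partials_on (\<lambda>z. h (z \<bullet> z)) (\<lambda>i z. 2 * h' (z \<bullet> z) * z $ i) UNIV"
  unfolding has_partials_on_def
proof (intro conjI ballI allI)
  fix z :: "real ^ 3"
  have "((\<lambda>z. z \<bullet> z) has_derivative (\<lambda>v. 2 * (z \<bullet> v))) (at z)"
    by (rule has_derivative_eq_rhs[OF has_derivative_inner[OF has_derivative_ident has_derivative_ident]])
      (simp add: inner_commute fun_eq_iff)
  from has_derivative_compose[OF this assms(1)[of "z \<bullet> z", unfolded has_field_derivative_def]]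
  show "((\<lambda>z. h (z \<bullet> z)) has_derivative (\<lambda>v. \<Sum>i\<in>UNIV. v $ i *\<^sub>R (2 * h' (z \<bullet> z) * z $ i))) (at z)"
    by (rule has_derivative_eq_rhs) (simp add: inner_vec_def sum_3 algebra_simps fun_eq_iff)
next
  fix i :: 3
  show "continuous_on UNIV (\<lambda>z. 2 * h' (z \<bullet> z) * z $ i)"
    by (intro continuous_intros continuous_on_compose2[OF assms(2)]) auto
qed

lemma has_partials_on_bump: "has_partials_on bump bump_partial UNIV"
  unfolding bump_def[abs_def] bump_partial_def[abs_def]
  by (rule has_partials_on_radial[OF bump_profile_deriv]) (auto intro!: continuous_intros)

lemma has_partials_on_nth: "has_partials_on (\<lambda>z. z $ j) (\<lambda>i z. if i = j then 1 else (0::real)) S"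
  unfolding has_partials_on_def
proof (intro conjI ballI allI)
  fix x :: "real ^ 3"
  show "((\<lambda>z. z $ j) has_derivative (\<lambda>v. \<Sum>i\<in>UNIV. v $ i *\<^sub>R (if i = j then 1 else (0::real)))) (at x)"
    by (rule has_derivative_eq_rhs[OF bounded_linear.has_derivative[OF bounded_linear_vec_nth has_derivative_ident]])
      (use exhaust_3[of j] in \<open>auto simp: sum_3\<close>)
qed auto

lemma has_partials_on_dyadic_field:
  "has_partials_on (dyadic_field j) (dyadic_field_partial j) UNIV"
proof -
  note has_partials_on_mult[OF has_partials_on_radial[OF dyadic_profile_deriv continuous_on_dyadic_profile'] has_partials_on_nth, of j]
  moreover have "(\<lambda>z. dyadic_profile (z \<bullet> z) * z $ j) = dyadic_field j"
    by (simp add: dyadic_field_def fun_eq_iff)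
  moreover have "(\<lambda>i z. dyadic_profile (z \<bullet> z) * (if i = j then 1 else 0) + 2 * dyadic_profile' (z \<bullet> z) * z $ i * z $ j)
      = dyadic_field_partial j"
    by (auto simp: dyadic_field_partial_def fun_eq_iff)
  ultimately show ?thesis by simp
qed

text \<open>A radial profile times \<open>z\<close> is a gradient field, so its Jacobian is
  symmetric. In \<open>moll_step\<close> this collects the kernels into the partials of the single
  function \<open>dyadic_field j\<close>.\<close>

lemma dyadic_field_partial_sym: "dyadic_field_partial i j = dyadic_field_partial j i"
  by (auto simp: dyadic_field_partial_def fun_eq_iff)

text \<open>The factor \<open>8\<close> is the volume factor of halving the scale: after rescaling,
  the right-hand side is a difference of two mollifiers of equal mass.\<close>

lemma dyadic_field_div:
  "(\<Sum>j\<in>UNIV. dyadic_field_partial j j z) = bump z - 8 * bump (2 *\<^sub>R z)"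
proof -
  have "(\<Sum>j\<in>UNIV. dyadic_field_partial j j z) = 3 * dyadic_profile (z \<bullet> z) + 2 * (z \<bullet> z) * dyadic_profile' (z \<bullet> z)"
    by (simp add: dyadic_field_partial_def sum_3 inner_vec_def algebra_simps)
  also have "\<dots> = bump_profile (z \<bullet> z) - 8 * bump_profile (4 * (z \<bullet> z))"
    by (simp add: dyadic_profile_def dyadic_profile'_def bump_profile_eq[symmetric] algebra_simps)
  finally show ?thesis by (simp add: bump_def)
qed

lemma kernels_eq_0:
  assumes "norm z \<ge> 1"
  shows "bump z = 0" "bump_partial i z = 0" "dyadic_field j z = 0" "dyadic_field_partial j i z = 0"
proof -
  have "1 \<le> z \<bullet> z" using assms by (simp add: dot_square_norm)
  then show "bump z = 0" "bump_partial i z = 0" "dyadic_field j z = 0" "dyadic_field_partial j i z = 0"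
    by (simp_all add: bump_def bump_profile_def bump_partial_def dyadic_field_def dyadic_field_partial_def dyadic_profile_eq_0)
qed

lemma kernel_bounded:
  fixes g :: "real ^ 3 \<Rightarrow> real"
  assumes "continuous_on UNIV g" "\<And>z. norm z \<ge> 1 \<Longrightarrow> g z = 0"
  shows "\<exists>C>0. \<forall>z. \<bar>g z\<bar> \<le> C"
proof -
  have "bounded (g ` cball 0 1)"
    by (intro compact_imp_bounded compact_continuous_image continuous_on_subset[OF assms(1)]) auto
  then obtain C where C: "C > 0" "\<And>z. z \<in> cball 0 1 \<Longrightarrow> \<bar>g z\<bar> \<le> C"
    unfolding bounded_pos by auto
  have "\<bar>g z\<bar> \<le> C" for z
    using C assms(2)[of z] by (cases "norm z \<le> 1") auto
  with C(1) show ?thesis by blast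
qed

text \<open>Compact support turns continuity into global bounds; summing over the finitely many
  indices gives one constant for all kernels.\<close>

lemma kernels_bounded:
  "\<exists>C>0. (\<forall>z. \<bar>bump z\<bar> \<le> C) \<and> (\<forall>i z. \<bar>bump_partial i z\<bar> \<le> C) \<and>
    (\<forall>j z. \<bar>dyadic_field j z\<bar> \<le> C) \<and> (\<forall>j i z. \<bar>dyadic_field_partial j i z\<bar> \<le> C)"
proof -
  have "\<exists>C>0. \<forall>z. \<bar>bump z\<bar> \<le> C"
    by (rule kernel_bounded[OF has_partials_on_continuous[OF has_partials_on_bump] kernels_eq_0(1)])
  then obtain C1 where C1: "C1 > 0" "\<And>z. \<bar>bump z\<bar> \<le> C1" by blast
  have "\<exists>C>0. \<forall>z. \<bar>bump_partial i z\<bar> \<le> C" for i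
    by (rule kernel_bounded[OF has_partials_on_continuous_partial[OF has_partials_on_bump] kernels_eq_0(2)])
  then obtain C2 where C2: "\<And>i. C2 i > 0" "\<And>i z. \<bar>bump_partial i z\<bar> \<le> C2 i" by metis
  have "\<exists>C>0. \<forall>z. \<bar>dyadic_field i z\<bar> \<le> C" for i
    by (rule kernel_bounded[OF has_partials_on_continuous[OF has_partials_on_dyadic_field] kernels_eq_0(3)])
  then obtain C3 where C3: "\<And>i. C3 i > 0" "\<And>i z. \<bar>dyadic_field i z\<bar> \<le> C3 i" by metis
  have "\<exists>C>0. \<forall>z. \<bar>dyadic_field_partial j i z\<bar> \<le> C" for j i
    by (rule kernel_bounded[OF has_partials_on_continuous_partial[OF has_partials_on_dyadic_field] kernels_eq_0(4)])
  then obtain C4 where C4: "\<And>j i. C4 j i > 0" "\<And>j i z. \<bar>dyadic_field_partial j i z\<bar> \<le> C4 j i" by metis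
  define C where "C = C1 + (\<Sum>i\<in>UNIV. C2 i) + (\<Sum>i\<in>UNIV. C3 i) + (\<Sum>j\<in>UNIV. \<Sum>i\<in>UNIV. C4 j i)"
  have s2: "C2 i \<le> (\<Sum>i\<in>UNIV. C2 i)" "C3 i \<le> (\<Sum>i\<in>UNIV. C3 i)" for i
    using less_imp_le[OF C2(1)] less_imp_le[OF C3(1)] by (auto intro: member_le_sum)
  have "C4 j i \<le> (\<Sum>i\<in>UNIV. C4 j i)" for i j
    using less_imp_le[OF C4(1)] by (auto intro: member_le_sum)
  also have "(\<Sum>i\<in>UNIV. C4 j i) \<le> (\<Sum>j\<in>UNIV. \<Sum>i\<in>UNIV. C4 j i)" for j
    using less_imp_le[OF C4(1)] by (intro member_le_sum[of j UNIV "\<lambda>j. \<Sum>i\<in>UNIV. C4 j i"]) (auto intro!: sum_nonneg)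
  finally have s4: "C4 j i \<le> (\<Sum>j\<in>UNIV. \<Sum>i\<in>UNIV. C4 j i)" for i j .
  have p: "0 \<le> (\<Sum>i\<in>UNIV. C2 i)" "0 \<le> (\<Sum>i\<in>UNIV. C3 i)" "0 \<le> (\<Sum>j\<in>UNIV. \<Sum>i\<in>UNIV. C4 j i)"
    using less_imp_le[OF C2(1)] less_imp_le[OF C3(1)] less_imp_le[OF C4(1)] by (auto intro!: sum_nonneg)
  show ?thesis
  proof (intro exI[of _ C] conjI allI)
    show "C > 0" using C1(1) p by (simp add: C_def)
    show "\<bar>bump z\<bar> \<le> C" for z using C1(2)[of z] p by (simp add: C_def)
    show "\<bar>bump_partial i z\<bar> \<le> C" for i z using C2(2)[of i z] s2(1)[of i] C1(1) p unfolding C_def by linarith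
    show "\<bar>dyadic_field i z\<bar> \<le> C" for i z using C3(2)[of i z] s2(2)[of i] C1(1) p unfolding C_def by linarith
    show "\<bar>dyadic_field_partial j i z\<bar> \<le> C" for j i z using C4(2)[of j i z] s4[of j i] C1(1) p unfolding C_def by linarith
  qed
qed

section \<open>Convolution with rescaled kernels\<close>

text \<open>The integral runs over a fixed box, so \<open>F\<close> only has to be controlled there.
  For kernels supported in the unit ball this is the usual convolution once \<open>cball x s\<close>
  lies in the box. Normalising powers of \<open>s\<close> are added by the users.\<close>

definition kernel_conv ::
    "real ^ 3 \<Rightarrow> real ^ 3 \<Rightarrow> (real ^ 3 \<Rightarrow> real) \<Rightarrow> real \<Rightarrow> (real ^ 3 \<Rightarrow> complex) \<Rightarrow> real ^ 3 \<Rightarrow> complex"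
  where "kernel_conv a b \<kappa> s F x = integral (cbox a b) (\<lambda>y. \<kappa> ((x - y) /\<^sub>R s) *\<^sub>R F y)"

lemma kernel_conv_integrable:
  fixes F :: "real ^ 3 \<Rightarrow> complex"
  assumes "continuous_on UNIV \<kappa>" "continuous_on (cbox a b) F"
  shows "(\<lambda>y. \<kappa> ((x - y) /\<^sub>R s) *\<^sub>R F y) integrable_on cbox a b"
  by (intro integrable_continuous continuous_on_scaleR assms(2)
      continuous_on_compose2[OF assms(1), of _ "\<lambda>y. (x - y) /\<^sub>R s"]) (auto intro!: continuous_intros)

lemma kernel_conv_diff:
  assumes "continuous_on UNIV \<kappa>" "continuous_on (cbox a b) F" "continuous_on (cbox a b) G"
  shows "kernel_conv a b \<kappa> s (\<lambda>y. F y - G y) x = kernel_conv a b \<kappa> s F x - kernel_conv a b \<kappa> s G x"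
  using integral_diff[OF kernel_conv_integrable[OF assms(1,2)] kernel_conv_integrable[OF assms(1,3)]]
  by (simp add: kernel_conv_def scaleR_diff_right)

text \<open>Differentiating under the integral puts the derivative on the kernel, so continuity of
  \<open>F\<close> suffices; the chain rule gives the factor \<open>1 / s\<close>.\<close>

lemma kernel_conv_has_derivative:
  assumes k: "has_partials_on \<kappa> g UNIV" and F: "continuous_on (cbox a b) F"
  shows "(kernel_conv a b \<kappa> s F has_derivative (\<lambda>v. \<Sum>i\<in>UNIV. (v $ i) *\<^sub>R (kernel_conv a b (g i) s F x /\<^sub>R s))) (at x)"
proof -
  define w where "w x y = (\<chi> i. g i ((x - y) /\<^sub>R s) / s)" for x y
  \<comment> \<open>The linear map \<open>v \<mapsto> (w x y \<bullet> v) *\<^sub>R F y\<close> as a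
    bounded operator, the form of derivative that the Leibniz rule takes.\<close>
  define fx where "fx x y = blinfun_scaleR_left (F y) o\<^sub>L blinfun_inner_left (w x y)" for x y
  have cg: "continuous_on UNIV (g i)" for i by (rule has_partials_on_continuous_partial[OF k])
  have ck: "continuous_on UNIV \<kappa>" by (rule has_partials_on_continuous[OF k])
  have cw: "continuous_on A (\<lambda>p. w (fst p) (snd p))" for A
    unfolding w_def divide_inverse
    by (intro continuous_on_vec_lambda continuous_on_mult_right
      continuous_on_compose2[OF cg, of _ "\<lambda>p. (fst p - snd p) /\<^sub>R s"]) (auto intro!: continuous_intros)
  have cfx: "continuous_on (UNIV \<times> cbox a b) (\<lambda>p. fx (fst p) (snd p))"
    unfolding fx_def
    by (intro bounded_bilinear.continuous_on[OF bounded_bilinear_blinfun_compose]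
      bounded_linear.continuous_on[OF bounded_linear_blinfun_scaleR_left]
      bounded_linear.continuous_on[OF bounded_linear_blinfun_inner_left] cw
      continuous_on_compose2[OF F, of _ snd]) (auto intro!: continuous_intros)
  have "((\<lambda>x. integral (cbox a b) (\<lambda>y. \<kappa> ((x - y) /\<^sub>R s) *\<^sub>R F y)) has_derivative
      blinfun_apply (integral (cbox a b) (fx x))) (at x within UNIV)"
  proof (rule leibniz_rule)
    fix x y :: "real ^ 3"
    have "((\<lambda>x. (x - y) /\<^sub>R s) has_derivative (\<lambda>v. v /\<^sub>R s)) (at x)"
      by (auto intro!: derivative_eq_intros)
    from has_derivative_compose[OF this has_partials_on_derivative[OF k UNIV_I]]
    have "((\<lambda>x. \<kappa> ((x - y) /\<^sub>R s) *\<^sub>R F y) has_derivative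
       (\<lambda>v. (\<Sum>i\<in>UNIV. (v /\<^sub>R s) $ i *\<^sub>R g i ((x - y) /\<^sub>R s)) *\<^sub>R F y)) (at x)"
      by (rule has_derivative_scaleR_left)
    then show "((\<lambda>x. \<kappa> ((x - y) /\<^sub>R s) *\<^sub>R F y) has_derivative blinfun_apply (fx x y)) (at x within UNIV)"
      by (rule has_derivative_eq_rhs)
        (simp add: fx_def w_def fun_eq_iff inner_vec_def divide_inverse mult_ac)
  next
    show "continuous_on (UNIV \<times> cbox a b) (\<lambda>(x, y). fx x y)" using cfx by (simp add: split_beta)
  qed (auto intro: kernel_conv_integrable[OF ck F])
  then have d: "(kernel_conv a b \<kappa> s F has_derivative blinfun_apply (integral (cbox a b) (fx x))) (at x)"
    by (simp add: kernel_conv_def[abs_def])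
  have e: "blinfun_apply (integral (cbox a b) (fx x)) v =
      (\<Sum>i\<in>UNIV. (v $ i) *\<^sub>R (kernel_conv a b (g i) s F x /\<^sub>R s))" for v
  proof -
    have "continuous_on (cbox a b) (fx x)"
      by (rule continuous_on_compose2[OF cfx, of _ "\<lambda>y. (x, y)", simplified]) (auto intro!: continuous_intros)
    then have "fx x integrable_on cbox a b" by (rule integrable_continuous)
    then have "blinfun_apply (integral (cbox a b) (fx x)) v = integral (cbox a b) ((\<lambda>f. blinfun_apply f v) \<circ> fx x)"
      by (intro integral_linear[symmetric] bounded_linear_intros)
    also have "\<dots> = integral (cbox a b) (\<lambda>y. \<Sum>i\<in>UNIV. (v $ i / s) *\<^sub>R (g i ((x - y) /\<^sub>R s) *\<^sub>R F y))"
      by (simp add: fx_def w_def o_def inner_vec_def scaleR_sum_left)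
    also have "\<dots> = (\<Sum>i\<in>UNIV. integral (cbox a b) (\<lambda>y. (v $ i / s) *\<^sub>R (g i ((x - y) /\<^sub>R s) *\<^sub>R F y)))"
      by (intro integral_sum integrable_cmul kernel_conv_integrable[OF cg F]) auto
    also have "\<dots> = (\<Sum>i\<in>UNIV. (v $ i) *\<^sub>R (kernel_conv a b (g i) s F x /\<^sub>R s))"
      unfolding integral_cmul kernel_conv_def by (simp add: divide_inverse)
    finally show ?thesis .
  qed
  show ?thesis using d by (rule has_derivative_eq_rhs) (rule ext, rule e)
qed

lemma outside_kernel_support:
  fixes x y :: "real ^ 3"
  assumes "s > 0" "y \<notin> cball x s" shows "norm ((x - y) /\<^sub>R s) \<ge> 1"
  using assms by (simp add: dist_norm divide_simps)

text \<open>Only the ball of radius \<open>s\<close> contributes, and it lies in a cube of side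
  \<open>2 * s\<close>, whose volume is \<open>8 * s ^ 3\<close>.\<close>

lemma norm_conv_le:
  assumes k: "continuous_on UNIV \<kappa>" "\<And>z. \<bar>\<kappa> z\<bar> \<le> C" "\<And>z. norm z \<ge> 1 \<Longrightarrow> \<kappa> z = 0" and "s > 0"
    and F: "continuous_on (cbox a b) F" "\<And>y. y \<in> cbox a b \<Longrightarrow> dist x y \<le> s \<Longrightarrow> norm (F y) \<le> M" and "M \<ge> 0"
  shows "norm (kernel_conv a b \<kappa> s F x) \<le> 8 * C * M * s ^ 3"
proof -
  have C: "C \<ge> 0" using k(2)[of 0] by linarith
  define o1 :: "real ^ 3" where "o1 = (\<chi> i. s)"
  define g where "g y = \<kappa> ((x - y) /\<^sub>R s) *\<^sub>R F y" for y
  define Q where "Q = cbox (x - o1) (x + o1)"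
  have Q: "cball x s \<subseteq> Q"
  proof
    fix y assume y: "y \<in> cball x s"
    have "\<bar>(x - y) $ i\<bar> \<le> s" for i
      using component_le_norm_cart[of "x - y" i] y by (simp add: dist_norm)
    then show "y \<in> Q" by (auto simp: Q_def o1_def mem_box_cart abs_le_iff algebra_simps)
  qed
  have zero: "g y = 0" if "y \<notin> cball x s" for y
    using outside_kernel_support[OF \<open>s > 0\<close> that] k(3) by (simp add: g_def)
  \<comment> \<open>The cube may stick out of the integration box, but the intersection is again a
    box, to which the bound by content applies.\<close>
  obtain c d where cd: "Q \<inter> cbox a b = cbox c d" unfolding Q_def using Int_interval by blast
  have "g y = 0" if "y \<notin> Q" for y using zero Q that by blast
  then have "(\<lambda>y. if y \<in> Q then g y else 0) = g" by auto
  then have I: "integral (cbox a b) g = integral (cbox c d) g"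
    using integral_restrict_Int[of "cbox a b" Q g] cd by simp
  have "g integrable_on cbox a b" unfolding g_def by (rule kernel_conv_integrable[OF k(1) F(1)])
  then have "g integrable_on cbox c d" by (rule integrable_on_subcbox) (use cd in blast)
  then have "(g has_integral integral (cbox c d) g) (cbox c d)" by (rule integrable_integral)
  then have "norm (integral (cbox c d) g) \<le> C * M * measure lborel (cbox c d)"
  proof (rule has_integral_bound[rotated])
    show "0 \<le> C * M" using C \<open>M \<ge> 0\<close> by simp
    fix y assume y: "y \<in> cbox c d"
    show "norm (g y) \<le> C * M"
    proof (cases "y \<in> cball x s")
      case True
      then have "norm (F y) \<le> M" using F(2)[of y] y cd by auto
      then show ?thesis unfolding g_def norm_scaleR using k(2) C by (intro mult_mono) auto
    qed (use zero C \<open>M \<ge> 0\<close> in simp)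
  qed
  also have "measure lborel (cbox c d) \<le> measure lborel Q"
    unfolding Q_def by (rule content_subset) (use cd Q_def in blast)
  also have "measure lborel Q = (2 * s) ^ 3"
  proof -
    have "x \<in> Q" using Q \<open>s > 0\<close> by auto
    then show ?thesis unfolding Q_def
      by (subst content_cbox_cart) (auto simp: o1_def)
  qed
  finally have "norm (integral (cbox c d) g) \<le> 8 * C * M * s ^ 3"
    using mult_right_mono[of _ _ "C * M"] C \<open>M \<ge> 0\<close> by (simp add: power_mult_distrib mult_ac)
  moreover have "kernel_conv a b \<kappa> s F x = integral (cbox a b) g" by (simp add: kernel_conv_def g_def[abs_def])
  ultimately show ?thesis using I by simp
qed

text \<open>The rescaled kernel as a function of the integration variable, whence the minus sign.
  Complex values make it admissible as a test function.\<close>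

lemma has_partials_on_reflect:
  assumes "has_partials_on \<kappa> g UNIV"
  shows "has_partials_on (\<lambda>y. complex_of_real (\<kappa> ((x - y) /\<^sub>R s)))
    (\<lambda>i y. - complex_of_real (g i ((x - y) /\<^sub>R s)) / of_real s) S"
  unfolding has_partials_on_def
proof (intro conjI ballI allI)
  fix y
  have "((\<lambda>y. (x - y) /\<^sub>R s) has_derivative (\<lambda>v. - v /\<^sub>R s)) (at y)"
    by (auto intro!: derivative_eq_intros)
  from has_derivative_compose[OF this has_partials_on_derivative[OF assms UNIV_I]]
  have "((\<lambda>y. complex_of_real (\<kappa> ((x - y) /\<^sub>R s))) has_derivative
       (\<lambda>v. complex_of_real (\<Sum>i\<in>UNIV. (- v /\<^sub>R s) $ i *\<^sub>R g i ((x - y) /\<^sub>R s)))) (at y)"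
    by (rule has_derivative_of_real)
  then show "((\<lambda>y. complex_of_real (\<kappa> ((x - y) /\<^sub>R s))) has_derivative
      (\<lambda>v. \<Sum>i\<in>UNIV. v $ i *\<^sub>R (- complex_of_real (g i ((x - y) /\<^sub>R s)) / of_real s))) (at y)"
    by (rule has_derivative_eq_rhs)
      (simp add: scaleR_conv_of_real[where 'a = complex] divide_inverse mult_ac)
next
  fix i
  have "continuous_on S (\<lambda>y. g i ((x - y) /\<^sub>R s))"
    by (rule continuous_on_compose2[OF has_partials_on_continuous_partial[OF assms]])
      (auto intro!: continuous_intros)
  then show "continuous_on S (\<lambda>y. - complex_of_real (g i ((x - y) /\<^sub>R s)) / of_real s)"
    unfolding divide_inverse by (intro continuous_intros)
qed

text \<open>Derivatives of a compactly supported kernel have mean zero. This is what later permits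
  replacing \<open>h\<close> by \<open>h - h x\<close>.\<close>

lemma kernel_conv_partial_const_eq_0:
  assumes k: "has_partials_on \<kappa> g UNIV" "\<And>z. norm z \<ge> 1 \<Longrightarrow> \<kappa> z = 0" and "s > 0" "cball x s \<subseteq> box a b"
  shows "kernel_conv a b (g i) s (\<lambda>_. c) x = 0"
proof -
  have "integral (cbox a b) (\<lambda>y. - complex_of_real (g i ((x - y) /\<^sub>R s)) / of_real s) = 0"
    by (rule integral_partial_eq_0[OF open_UNIV _ has_partials_on_reflect[OF k(1)] compact_cball assms(4)])
      (use outside_kernel_support[OF \<open>s > 0\<close>] k(2) in auto)
  then have "integral (cbox a b) (\<lambda>y. complex_of_real (g i ((x - y) /\<^sub>R s))) = 0"
    using \<open>s > 0\<close> by simp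
  then show ?thesis by (simp add: kernel_conv_def scaleR_conv_of_real[where 'a = complex])
qed

lemma integral_times_reflect_partial:
  "integral (cbox a b) (\<lambda>y. G y * (- complex_of_real (g ((x - y) /\<^sub>R s)) / of_real s)) = - kernel_conv a b g s G x / of_real s"
proof -
  have "(\<lambda>y. G y * (- complex_of_real (g ((x - y) /\<^sub>R s)) / of_real s))
      = (\<lambda>y. (g ((x - y) /\<^sub>R s) *\<^sub>R G y) * (- 1 / of_real s))"
    by (simp add: fun_eq_iff scaleR_conv_of_real[where 'a = complex])
  then show ?thesis by (simp add: kernel_conv_def)
qed

section \<open>Mollification and its dyadic increments\<close>

definition moll :: "real ^ 3 \<Rightarrow> real ^ 3 \<Rightarrow> real \<Rightarrow> (real ^ 3 \<Rightarrow> complex) \<Rightarrow> real ^ 3 \<Rightarrow> complex"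
  where "moll a b s G x = kernel_conv a b bump s G x /\<^sub>R s ^ 3"

text \<open>Three powers of \<open>s\<close> come from the volume and one from the chain
  rule.\<close>

definition moll_partial :: "real ^ 3 \<Rightarrow> real ^ 3 \<Rightarrow> real \<Rightarrow> (real ^ 3 \<Rightarrow> complex) \<Rightarrow> 3 \<Rightarrow> real ^ 3 \<Rightarrow> complex"
  where "moll_partial a b s G i x = kernel_conv a b (bump_partial i) s G x /\<^sub>R s ^ 4"

lemma moll_has_derivative:
  assumes "continuous_on (cbox a b) G"
  shows "(moll a b s G has_derivative (\<lambda>v. \<Sum>i\<in>UNIV. (v $ i) *\<^sub>R moll_partial a b s G i x)) (at x)"
  unfolding moll_def[abs_def]
  by (rule has_derivative_eq_rhs[OF has_derivative_scaleR_right[OF kernel_conv_has_derivative[OF has_partials_on_bump assms]]])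
    (simp add: fun_eq_iff moll_partial_def scaleR_sum_right power_Suc numeral_eq_Suc mult_ac)

text \<open>This is \<open>dyadic_field_div\<close> rescaled, the factor \<open>8\<close> turning
  \<open>s ^ 3\<close> into \<open>(s / 2) ^ 3\<close>. It holds for every continuous
  \<open>G\<close>; the differential equation enters in \<open>moll_step\<close>.\<close>

lemma moll_halve:
  assumes G: "continuous_on (cbox a b) G" and "s > 0"
  shows "moll a b s G x - moll a b (s / 2) G x = (\<Sum>k\<in>UNIV. kernel_conv a b (dyadic_field_partial k k) s G x) /\<^sub>R s ^ 3"
proof -
  have c: "continuous_on UNIV bump" "continuous_on UNIV (dyadic_field_partial k k)" for k
    by (rule has_partials_on_continuous[OF has_partials_on_bump])
      (rule has_partials_on_continuous_partial[OF has_partials_on_dyadic_field])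
  have "2 * inverse s = inverse (s / 2)" using \<open>s > 0\<close> by (simp add: field_simps)
  then have z: "(2 * inverse s) *\<^sub>R (x - y) = (x - y) /\<^sub>R (s / 2)" for y by (rule arg_cong)
  have "(\<Sum>k\<in>UNIV. kernel_conv a b (dyadic_field_partial k k) s G x)
     = integral (cbox a b) (\<lambda>y. \<Sum>k\<in>UNIV. dyadic_field_partial k k ((x - y) /\<^sub>R s) *\<^sub>R G y)"
    unfolding kernel_conv_def by (intro integral_sum[symmetric] kernel_conv_integrable[OF c(2) G]) auto
  also have "\<dots> = integral (cbox a b) (\<lambda>y. bump ((x - y) /\<^sub>R s) *\<^sub>R G y - 8 *\<^sub>R (bump ((x - y) /\<^sub>R (s / 2)) *\<^sub>R G y))"
    by (simp only: scaleR_sum_left[symmetric] dyadic_field_div z scaleR_diff_left scaleR_scaleR)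
  also have "\<dots> = kernel_conv a b bump s G x - 8 *\<^sub>R kernel_conv a b bump (s / 2) G x"
    unfolding kernel_conv_def
    by (subst integral_diff) (intro kernel_conv_integrable[OF c(1) G] integrable_cmul, intro kernel_conv_integrable[OF c(1) G] integrable_cmul, simp only: integral_cmul)
  finally show ?thesis
    using \<open>s > 0\<close> by (simp add: moll_def scaleR_diff_right power_divide) (simp add: field_simps)
qed

lemma has_partials_on_unique:
  assumes "(g has_derivative (\<lambda>v. \<Sum>i\<in>UNIV. (v $ i) *\<^sub>R A i)) (at x)"
    "(g has_derivative (\<lambda>v. \<Sum>i\<in>UNIV. (v $ i) *\<^sub>R B i)) (at (x :: real ^ 3))"
  shows "A i = B i"
proof -
  have "(\<lambda>v::real^3. \<Sum>i\<in>UNIV. (v $ i) *\<^sub>R A i) = (\<lambda>v. \<Sum>i\<in>UNIV. (v $ i) *\<^sub>R B i)"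
    using assms by (rule has_derivative_unique)
  from fun_cong[OF this, of "axis i 1"] show ?thesis
    by (simp add: axis_def if_distrib if_distribR cong: if_cong)
qed

text \<open>\<open>u\<close> solves \<open>\<Delta>u = h\<close> weakly, and \<open>F = \<nabla>u\<close>.\<close>

locale weak_poisson =
  fixes S :: "(real ^ 3) set" and a b :: "real ^ 3" and u h :: "real ^ 3 \<Rightarrow> complex"
    and F :: "3 \<Rightarrow> real ^ 3 \<Rightarrow> complex" and x0 :: "real ^ 3" and \<rho> :: real
  assumes S: "open S" "cbox a b \<subseteq> S"
    and u: "has_partials_on u F S" and h: "continuous_on S h"
    and weak: "\<And>\<eta> H K. \<lbrakk>has_partials_on \<eta> H S; compact K; K \<subseteq> box a b; \<And>y. y \<notin> K \<Longrightarrow> \<eta> y = 0;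
        \<And>i y. y \<notin> K \<Longrightarrow> H i y = 0\<rbrakk> \<Longrightarrow>
      integral (cbox a b) (\<lambda>y. \<Sum>i\<in>UNIV. F i y * H i y) = - integral (cbox a b) (\<lambda>y. h y * \<eta> y)"
    and \<rho>: "\<rho> > 0" "cball x0 (2 * \<rho>) \<subseteq> box a b"
begin

lemma continuous_on_gradient: "continuous_on (cbox a b) (F i)"
  using has_partials_on_continuous_partial[OF u] S(2) continuous_on_subset by blast

lemma continuous_on_source: "continuous_on (cbox a b) h"
  using h S(2) continuous_on_subset by blast

text \<open>The margin \<open>2 * \<rho>\<close> leaves room for a centre up to \<rho> away from
  \<open>x0\<close> together with a scale up to \<rho>.\<close>

lemma ball_in_box: "dist x0 x \<le> \<rho> \<Longrightarrow> s \<le> \<rho> \<Longrightarrow> cball x s \<subseteq> box a b"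
proof
  fix y assume "dist x0 x \<le> \<rho>" "s \<le> \<rho>" "y \<in> cball x s"
  then have "dist x0 y \<le> 2 * \<rho>" using dist_triangle[of x0 y x] by simp
  then show "y \<in> box a b" using \<rho>(2) by auto
qed

context
  fixes \<kappa> :: "real ^ 3 \<Rightarrow> real" and g :: "3 \<Rightarrow> real ^ 3 \<Rightarrow> real" and s :: real and x :: "real ^ 3"
  assumes k: "has_partials_on \<kappa> g UNIV" "\<And>z. norm z \<ge> 1 \<Longrightarrow> \<kappa> z = 0" "\<And>i z. norm z \<ge> 1 \<Longrightarrow> g i z = 0"
    and s: "s > 0" "cball x s \<subseteq> box a b"
begin

text \<open>The weak form of "a gradient has no curl", with both derivatives moved towards the
  kernel by \<open>integral_partials_swap\<close>.\<close>

lemma kernel_conv_partial_swap: "kernel_conv a b (g k) s (F i) x = kernel_conv a b (g i) s (F k) x"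
proof -
  have "integral (cbox a b) (\<lambda>y. F i y * (- complex_of_real (g k ((x - y) /\<^sub>R s)) / of_real s)) =
    integral (cbox a b) (\<lambda>y. F k y * (- complex_of_real (g i ((x - y) /\<^sub>R s)) / of_real s))"
    by (rule integral_partials_swap[OF S u has_partials_on_reflect[OF k(1)] compact_cball s(2)])
      (use outside_kernel_support[OF s(1)] k in auto)
  then show ?thesis using s(1) unfolding integral_times_reflect_partial by simp
qed

text \<open>The weak equation tested with the rescaled kernel; the factor \<open>s\<close> undoes
  the chain rule.\<close>

lemma kernel_conv_partial_div: "(\<Sum>i\<in>UNIV. kernel_conv a b (g i) s (F i) x) = s *\<^sub>R kernel_conv a b \<kappa> s h x"
proof -
  have "integral (cbox a b) (\<lambda>y. \<Sum>i\<in>UNIV. F i y * (- complex_of_real (g i ((x - y) /\<^sub>R s)) / of_real s)) =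
    - integral (cbox a b) (\<lambda>y. h y * complex_of_real (\<kappa> ((x - y) /\<^sub>R s)))"
    by (rule weak[OF has_partials_on_reflect[OF k(1)] compact_cball s(2)])
      (use outside_kernel_support[OF s(1)] k in auto)
  also have "(\<lambda>y. h y * complex_of_real (\<kappa> ((x - y) /\<^sub>R s))) = (\<lambda>y. \<kappa> ((x - y) /\<^sub>R s) *\<^sub>R h y)"
    by (simp add: scaleR_conv_of_real[where 'a = complex] mult.commute fun_eq_iff)
  also have "integral (cbox a b) (\<lambda>y. \<Sum>i\<in>UNIV. F i y * (- complex_of_real (g i ((x - y) /\<^sub>R s)) / of_real s)) =
    (\<Sum>i\<in>UNIV. integral (cbox a b) (\<lambda>y. F i y * (- complex_of_real (g i ((x - y) /\<^sub>R s)) / of_real s)))"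
    by (intro integral_sum integrable_continuous continuous_on_mult continuous_on_gradient
      has_partials_on_continuous_partial[OF has_partials_on_reflect[OF k(1)]]) auto
  also have "\<dots> = - (\<Sum>i\<in>UNIV. kernel_conv a b (g i) s (F i) x) / of_real s"
    unfolding integral_times_reflect_partial by (simp add: sum_negf sum_divide_distrib)
  finally have "(\<Sum>i\<in>UNIV. kernel_conv a b (g i) s (F i) x) / of_real s = kernel_conv a b \<kappa> s h x"
    by (simp add: kernel_conv_def)
  then show ?thesis using s(1) by (simp add: scaleR_conv_of_real[where 'a = complex] field_simps)
qed

end

text \<open>By \<open>moll_halve\<close> the increment pairs the single component \<open>F j\<close>
  with a divergence of kernels. The swap and the symmetry of the Jacobian turn this into the pairing
  of the full gradient \<open>F\<close> with the partials of \<open>dyadic_field j\<close>, where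
  the weak equation applies and gains one power of \<open>s\<close>.\<close>

lemma moll_step:
  assumes "s > 0" "cball x s \<subseteq> box a b"
  shows "moll a b s (F j) x - moll a b (s / 2) (F j) x = kernel_conv a b (dyadic_field j) s h x /\<^sub>R s ^ 2"
proof -
  note ds = has_partials_on_dyadic_field kernels_eq_0(3) kernels_eq_0(4) assms
  have "(\<Sum>k\<in>UNIV. kernel_conv a b (dyadic_field_partial k k) s (F j) x) = (\<Sum>k\<in>UNIV. kernel_conv a b (dyadic_field_partial k j) s (F k) x)"
    by (intro sum.cong refl kernel_conv_partial_swap[OF ds])
  also have "\<dots> = (\<Sum>k\<in>UNIV. kernel_conv a b (dyadic_field_partial j k) s (F k) x)"
    by (simp add: dyadic_field_partial_sym[of _ j])
  also have "\<dots> = s *\<^sub>R kernel_conv a b (dyadic_field j) s h x"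
    by (rule kernel_conv_partial_div[OF ds])
  finally have "moll a b s (F j) x - moll a b (s / 2) (F j) x = (s *\<^sub>R kernel_conv a b (dyadic_field j) s h x) /\<^sub>R s ^ 3"
    using moll_halve[OF continuous_on_gradient assms(1), of j x] by simp
  also have "\<dots> = kernel_conv a b (dyadic_field j) s h x /\<^sub>R s ^ 2"
    using assms(1) by (simp add: power2_eq_square power3_eq_cube)
  finally show ?thesis .
qed

lemma moll_partial_sym:
  assumes "s > 0" "cball x s \<subseteq> box a b"
  shows "moll_partial a b s (F j) i x = moll_partial a b s (F i) j x"
  unfolding moll_partial_def
  using kernel_conv_partial_swap[OF has_partials_on_bump kernels_eq_0(1) kernels_eq_0(2) assms, of i j] by simp

lemma moll_partial_div:
  assumes "s > 0" "cball x s \<subseteq> box a b"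
  shows "(\<Sum>j\<in>UNIV. moll_partial a b s (F j) j x) = moll a b s h x"
  using kernel_conv_partial_div[OF has_partials_on_bump kernels_eq_0(1) kernels_eq_0(2) assms] assms(1)
  by (simp add: moll_partial_def moll_def scaleR_sum_right[symmetric] power_Suc numeral_eq_Suc)

text \<open>The identity \<open>moll_step\<close> holds on an open ball around \<open>x0\<close>, so
  both sides may be differentiated at its points and their partials compared.\<close>

lemma moll_partial_step:
  assumes s: "s > 0" "s \<le> \<rho>" and x: "dist x0 x < \<rho>"
  shows "moll_partial a b s (F j) i x - moll_partial a b (s / 2) (F j) i x =
    kernel_conv a b (dyadic_field_partial j i) s h x /\<^sub>R s ^ 3"
proof -
  have "((\<lambda>x. moll a b s (F j) x - moll a b (s / 2) (F j) x) has_derivative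
    (\<lambda>v. \<Sum>i\<in>UNIV. v $ i *\<^sub>R (moll_partial a b s (F j) i x - moll_partial a b (s / 2) (F j) i x))) (at x)"
    by (rule has_derivative_eq_rhs[OF has_derivative_diff[OF moll_has_derivative[OF continuous_on_gradient] moll_has_derivative[OF continuous_on_gradient]]])
      (simp add: fun_eq_iff scaleR_diff_right sum_subtractf)
  moreover have "((\<lambda>x. moll a b s (F j) x - moll a b (s / 2) (F j) x) has_derivative
    (\<lambda>v. \<Sum>i\<in>UNIV. v $ i *\<^sub>R (kernel_conv a b (dyadic_field_partial j i) s h x /\<^sub>R s ^ 3))) (at x)"
  proof (rule has_derivative_transform_within_open[OF _ open_ball])
    show "((\<lambda>x. kernel_conv a b (dyadic_field j) s h x /\<^sub>R s ^ 2) has_derivative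
      (\<lambda>v. \<Sum>i\<in>UNIV. v $ i *\<^sub>R (kernel_conv a b (dyadic_field_partial j i) s h x /\<^sub>R s ^ 3))) (at x)"
      by (rule has_derivative_eq_rhs[OF has_derivative_scaleR_right[OF kernel_conv_has_derivative[OF has_partials_on_dyadic_field continuous_on_source]]])
        (simp add: fun_eq_iff scaleR_sum_right power_Suc numeral_eq_Suc mult_ac)
    show "x \<in> ball x0 \<rho>" using x by simp
    fix y assume "y \<in> ball x0 \<rho>"
    then show "kernel_conv a b (dyadic_field j) s h y /\<^sub>R s ^ 2 = moll a b s (F j) y - moll a b (s / 2) (F j) y"
      using moll_step[OF s(1) ball_in_box[of y s]] s(2) by simp
  qed
  ultimately show ?thesis by (rule has_partials_on_unique)
qed

end

section \<open>Dyadic sums and the limit of the mollifications\<close>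

lemma norm_sum_partials_le:
  fixes A :: "3 \<Rightarrow> 'a::real_normed_vector" and v :: "real ^ 3"
  assumes "\<And>i. norm (A i) \<le> c"
  shows "norm (\<Sum>i\<in>UNIV. v $ i *\<^sub>R A i) \<le> 3 * c * norm v"
proof -
  have "norm (\<Sum>i\<in>UNIV. v $ i *\<^sub>R A i) \<le> (\<Sum>i\<in>(UNIV :: 3 set). norm v * c)"
    by (rule sum_norm_le) (auto intro!: mult_mono component_le_norm_cart assms)
  then show ?thesis by (simp add: mult_ac)
qed

lemma dyadic_tail_le:
  fixes f :: "nat \<Rightarrow> 'a::real_normed_vector"
  assumes "f \<longlonglongrightarrow> l" "\<And>n. norm (f (Suc n) - f n) \<le> K * (r / 2 ^ n)"
  shows "norm (l - f n) \<le> 2 * K * (r / 2 ^ n)"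
proof -
  have K: "0 \<le> K * r" using order_trans[OF norm_ge_zero assms(2)[of 0]] by simp
  \<comment> \<open>Keeping the remainder \<open>r / 2 ^ (n + k)\<close> in the bound makes the
    induction close with the constant \<open>2 * K\<close>.\<close>
  have le: "norm (f (n + k) - f n) \<le> 2 * K * (r / 2 ^ n - r / 2 ^ (n + k))" for k
  proof (induction k)
    case (Suc k)
    have "norm (f (n + Suc k) - f n) \<le> norm (f (Suc (n + k)) - f (n + k)) + norm (f (n + k) - f n)"
      using norm_triangle_ineq[of "f (Suc (n + k)) - f (n + k)" "f (n + k) - f n"] by simp
    also have "\<dots> \<le> K * (r / 2 ^ (n + k)) + 2 * K * (r / 2 ^ n - r / 2 ^ (n + k))"
      by (intro add_mono assms(2) Suc.IH)
    also have "\<dots> = 2 * K * (r / 2 ^ n - r / 2 ^ (n + Suc k))"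
      by (simp add: field_simps)
    finally show ?case .
  qed simp
  have "(\<lambda>k. norm (f (n + k) - f n)) \<longlonglongrightarrow> norm (l - f n)"
    using LIMSEQ_ignore_initial_segment[OF assms(1), of n]
    by (intro tendsto_intros) (simp add: add.commute)
  moreover have "norm (f (n + k) - f n) \<le> 2 * K * (r / 2 ^ n)" for k
  proof -
    have "2 * K * (r / 2 ^ n - r / 2 ^ (n + k)) = 2 * K * (r / 2 ^ n) - 2 * ((K * r) / 2 ^ (n + k))"
      by (simp add: algebra_simps)
    then show ?thesis using le[of k] K by (smt (verit) divide_nonneg_pos zero_less_power)
  qed
  ultimately show ?thesis by (intro LIMSEQ_le_const2) auto
qed

text \<open>Up to constants the terms are the values of \<open>t log (1/t)\<close> at dyadic
  \<open>t\<close>. Their summability is the Dini condition that \<open>gradient_regularity\<close>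
  needs.\<close>

lemma summable_linear_times_geometric: "summable (\<lambda>n. real (n + 2) / 2 ^ Suc n)"
proof (rule summable_ratio_test[of "3/4" 0])
  fix n :: nat
  have "real (Suc n + 2) / 2 ^ Suc (Suc n) = (real (Suc n + 2) / 2) / 2 ^ Suc n" by simp
  also have "\<dots> \<le> (3/4 * real (n + 2)) / 2 ^ Suc n" by (intro divide_right_mono) auto
  finally show "norm (real (Suc n + 2) / 2 ^ Suc (Suc n)) \<le> 3/4 * norm (real (n + 2) / 2 ^ Suc n)" by simp
qed simp

lemma moll_const: "moll a b s (\<lambda>_. c) x = c * moll a b s (\<lambda>_. 1) x"
proof -
  have e: "(\<lambda>y. bump ((x - y) /\<^sub>R s) *\<^sub>R c) = (\<lambda>y. c * (bump ((x - y) /\<^sub>R s) *\<^sub>R 1))"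
    by (simp add: scaleR_conv_of_real[where 'a = complex] mult.commute fun_eq_iff)
  have "kernel_conv a b bump s (\<lambda>_. c) x = c * kernel_conv a b bump s (\<lambda>_. 1) x"
    unfolding kernel_conv_def e by (rule integral_mult_right)
  then show ?thesis by (simp add: moll_def)
qed

lemma norm_conv_scaled_le:
  assumes k: "continuous_on UNIV \<kappa>" "\<And>z. \<bar>\<kappa> z\<bar> \<le> C" "\<And>z. norm z \<ge> 1 \<Longrightarrow> \<kappa> z = 0" and "s > 0"
    and F: "continuous_on (cbox a b) F" "\<And>y. y \<in> cbox a b \<Longrightarrow> dist x y \<le> s \<Longrightarrow> norm (F y) \<le> M" and "M \<ge> 0"
  shows "norm (kernel_conv a b \<kappa> s F x /\<^sub>R s ^ 3) \<le> 8 * C * M"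
  using norm_conv_le[OF assms] \<open>s > 0\<close> by (simp add: field_simps)

text \<open>The bump is not normalised, so the comparison is with \<open>G x\<close> times the
  mollified constant \<open>1\<close>. The difference is the mollification of
  \<open>G - G x\<close>, which is small on the support of the kernel.\<close>

lemma moll_approx:
  assumes C: "\<And>z. \<bar>bump z\<bar> \<le> C" and G: "continuous_on (cbox a b) G" and "s > 0"
    and e: "\<And>y. y \<in> cbox a b \<Longrightarrow> dist x y \<le> s \<Longrightarrow> norm (G y - G x) \<le> e" "0 \<le> e"
  shows "norm (moll a b s G x - G x * moll a b s (\<lambda>_. 1) x) \<le> 8 * C * e"
proof -
  have cb: "continuous_on UNIV bump" by (rule has_partials_on_continuous[OF has_partials_on_bump])
  have "moll a b s G x - G x * moll a b s (\<lambda>_. 1) x = moll a b s G x - moll a b s (\<lambda>_. G x) x"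
    by (simp add: moll_const[of a b s "G x"])
  also have "\<dots> = kernel_conv a b bump s (\<lambda>y. G y - G x) x /\<^sub>R s ^ 3"
    using kernel_conv_diff[OF cb G, of "\<lambda>_. G x" s x] by (simp add: moll_def scaleR_diff_right)
  finally show ?thesis
    using norm_conv_scaled_le[OF cb C kernels_eq_0(1) \<open>s > 0\<close>, of a b "\<lambda>y. G y - G x" x e] G e
    by (simp add: continuous_on_diff)
qed

context weak_poisson
begin

text \<open>The mass is not evaluated. It is positive at scale \<rho> and centre \<open>x0\<close>;
  it does not depend on the centre, nor on the dyadic scale, because the kernels
  \<open>bump_partial\<close> and \<open>dyadic_field_partial\<close> have mean zero.\<close>

lemma moll_mass:
  obtains m where "m > 0" "\<And>n x. dist x0 x < \<rho> \<Longrightarrow> moll a b (\<rho> / 2 ^ n) (\<lambda>_. 1) x = complex_of_real m"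
proof -
  have c1: "continuous_on (cbox a b) (\<lambda>_. 1 :: complex)" by (rule continuous_on_const)
  define m where "m = integral (cbox a b) (\<lambda>y. bump ((x0 - y) /\<^sub>R \<rho>)) / \<rho> ^ 3"
  have cb: "continuous_on (cbox a b) (\<lambda>y. bump ((x0 - y) /\<^sub>R \<rho>))"
    by (rule continuous_on_compose2[OF has_partials_on_continuous[OF has_partials_on_bump]])
      (auto intro!: continuous_intros)
  have x0: "x0 \<in> box a b" using \<rho> by auto
  have nn: "0 \<le> bump z" for z by (simp add: bump_def bump_profile_def)
  \<comment> \<open>A continuous nonnegative integrand with zero integral vanishes on the box, but
    the bump is \<open>105 / 8\<close> at the origin.\<close>
  have "integral (cbox a b) (\<lambda>y. bump ((x0 - y) /\<^sub>R \<rho>)) \<noteq> 0"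
  proof
    assume "integral (cbox a b) (\<lambda>y. bump ((x0 - y) /\<^sub>R \<rho>)) = 0"
    then have "bump ((x0 - x0) /\<^sub>R \<rho>) = 0"
      using integral_cbox_eq_0_iff[OF cb] x0 nn box_subset_cbox[of a b] by blast
    then show False by (simp add: bump_def bump_profile_def)
  qed
  moreover have "0 \<le> integral (cbox a b) (\<lambda>y. bump ((x0 - y) /\<^sub>R \<rho>))"
    by (intro integral_nonneg integrable_continuous cb) (simp add: nn)
  ultimately have m: "m > 0" using \<rho>(1) by (simp add: m_def)
  have "kernel_conv a b bump \<rho> (\<lambda>_. 1) x0 = complex_of_real (integral (cbox a b) (\<lambda>y. bump ((x0 - y) /\<^sub>R \<rho>)))"
    using integral_linear[OF integrable_continuous[OF cb] bounded_linear_of_real[where 'a = complex]]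
    by (simp add: kernel_conv_def o_def scaleR_conv_of_real[where 'a = complex])
  then have m0: "moll a b \<rho> (\<lambda>_. 1) x0 = complex_of_real m"
    by (simp add: moll_def m_def scaleR_conv_of_real[where 'a = complex] divide_inverse mult.commute)
  have m1: "moll a b \<rho> (\<lambda>_. 1) x = complex_of_real m" if x: "dist x0 x < \<rho>" for x
  proof -
    have "moll a b \<rho> (\<lambda>_. 1) x = moll a b \<rho> (\<lambda>_. 1) x0"
    proof (rule has_derivative_zero_unique[of "ball x0 \<rho>"])
      fix y assume y: "y \<in> ball x0 \<rho>"
      have "moll_partial a b \<rho> (\<lambda>_. 1) i y = 0" for i
        using kernel_conv_partial_const_eq_0[OF has_partials_on_bump kernels_eq_0(1) \<rho>(1) ball_in_box[of y \<rho>]] y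
        by (simp add: moll_partial_def)
      then show "(moll a b \<rho> (\<lambda>_. 1) has_derivative (\<lambda>h. 0)) (at y within ball x0 \<rho>)"
        using moll_has_derivative[OF c1, of \<rho> y] by (simp add: has_derivative_at_withinI)
    qed (use x \<rho>(1) in auto)
    then show ?thesis using m0 by simp
  qed
  have "moll a b (\<rho> / 2 ^ n) (\<lambda>_. 1) x = complex_of_real m" if x: "dist x0 x < \<rho>" for n x
  proof (induction n)
    case (Suc n)
    have s: "\<rho> / 2 ^ n > 0" "\<rho> / 2 ^ n \<le> \<rho>" using \<rho>(1) by (auto simp: field_simps)
    have "kernel_conv a b (dyadic_field_partial k k) (\<rho> / 2 ^ n) (\<lambda>_. 1) x = 0" for k
      by (rule kernel_conv_partial_const_eq_0[OF has_partials_on_dyadic_field kernels_eq_0(3) s(1) ball_in_box[OF _ s(2)]])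
        (use x in auto)
    then have "moll a b (\<rho> / 2 ^ n) (\<lambda>_. 1) x = moll a b (\<rho> / 2 ^ n / 2) (\<lambda>_. 1) x"
      using moll_halve[OF c1 s(1), of x] by simp
    then show ?case using Suc.IH by (simp add: mult.commute)
  qed (use m1[OF x] in simp)
  with m show ?thesis using that by blast
qed

lemma moll_tendsto:
  assumes m: "\<And>n x. dist x0 x < \<rho> \<Longrightarrow> moll a b (\<rho> / 2 ^ n) (\<lambda>_. 1) x = complex_of_real m"
    and G: "continuous_on (cbox a b) G" and x: "dist x0 x < \<rho>"
  shows "(\<lambda>n. moll a b (\<rho> / 2 ^ n) G x) \<longlonglongrightarrow> m * G x"
proof -
  obtain C where C: "C > 0" "\<And>z. \<bar>bump z\<bar> \<le> C" using kernels_bounded by blast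
  have xb: "x \<in> cbox a b" using ball_in_box[of x 0] x \<rho>(1) box_subset_cbox[of a b] by auto
  show ?thesis
  proof (rule LIMSEQ_I)
    fix e :: real assume e: "e > 0"
    \<comment> \<open>The factor \<open>8 * C\<close> of \<open>moll_approx\<close> then leaves the
      error \<open>e / 2\<close>.\<close>
    define e' where "e' = e / (16 * C)"
    have e': "e' > 0" using e C by (simp add: e'_def)
    obtain d where d: "d > 0" "\<And>y. y \<in> cbox a b \<Longrightarrow> dist y x < d \<Longrightarrow> dist (G y) (G x) < e'"
      using G[unfolded continuous_on_iff] xb e' by metis
    have "(\<lambda>n. \<rho> / 2 ^ n) \<longlonglongrightarrow> 0"
      by (rule LIMSEQ_divide_realpow_zero) simp
    then obtain N where N: "\<And>n. n \<ge> N \<Longrightarrow> \<rho> / 2 ^ n < d"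
      using d(1) \<rho>(1) by (auto simp: LIMSEQ_iff)
    have "norm (moll a b (\<rho> / 2 ^ n) G x - m * G x) < e" if n: "n \<ge> N" for n
    proof -
      have "norm (moll a b (\<rho> / 2 ^ n) G x - G x * moll a b (\<rho> / 2 ^ n) (\<lambda>_. 1) x) \<le> 8 * C * e'"
      proof (rule moll_approx[OF C(2) G])
        fix y assume "y \<in> cbox a b" "dist x y \<le> \<rho> / 2 ^ n"
        then show "norm (G y - G x) \<le> e'"
          using d(2)[of y] N[OF n] by (simp add: dist_norm norm_minus_commute)
      qed (use e' \<rho> in auto)
      also have "8 * C * e' < e" using C(1) e by (simp add: e'_def)
      finally show ?thesis using m[OF x] by (simp add: mult.commute)
    qed
    then show "\<exists>N. \<forall>n\<ge>N. norm (moll a b (\<rho> / 2 ^ n) G x - m * G x) < e" by blast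
  qed
qed

end

section \<open>Bootstrapping the gradient: first a modulus of continuity, then
  differentiability\<close>

context weak_poisson
begin

lemma radius_bounds: "\<rho> / 2 ^ n > 0" "\<rho> / 2 ^ n \<le> \<rho>"
  using \<rho>(1) by (auto simp: field_simps)

text \<open>The right-hand side is written as the scale times a normalised convolution, so
  \<open>norm_conv_scaled_le\<close> shows that it is of the order of the scale.\<close>

lemma moll_Suc_step:
  "dist x0 x < \<rho> \<Longrightarrow> moll a b (\<rho> / 2 ^ Suc n) (F j) x - moll a b (\<rho> / 2 ^ n) (F j) x
    = - ((\<rho> / 2 ^ n) *\<^sub>R (kernel_conv a b (dyadic_field j) (\<rho> / 2 ^ n) h x /\<^sub>R (\<rho> / 2 ^ n) ^ 3))"
proof -
  assume x: "dist x0 x < \<rho>"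
  define s where "s = \<rho> / 2 ^ n"
  have s: "s > 0" "s \<le> \<rho>" using radius_bounds by (simp_all add: s_def)
  have "moll a b s (F j) x - moll a b (s / 2) (F j) x = kernel_conv a b (dyadic_field j) s h x /\<^sub>R s ^ 2"
    using moll_step[OF s(1) ball_in_box[OF _ s(2)]] x by simp
  moreover have "s *\<^sub>R (kernel_conv a b (dyadic_field j) s h x /\<^sub>R s ^ 3) = kernel_conv a b (dyadic_field j) s h x /\<^sub>R s ^ 2"
    using s(1) by (simp add: power2_eq_square power3_eq_cube)
  moreover have "\<rho> / 2 ^ Suc n = s / 2" by (simp add: s_def)
  ultimately show ?thesis unfolding s_def[symmetric] by (metis minus_diff_eq)
qed

text \<open>There is one power of the scale less than in \<open>moll_Suc_step\<close>: a bound on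
  \<open>h\<close> only bounds these increments, and summing them takes a modulus of continuity of
  \<open>h\<close>.\<close>

lemma moll_partial_Suc_step:
  assumes "dist x0 x < \<rho>"
  shows "moll_partial a b (\<rho> / 2 ^ Suc n) (F j) i x - moll_partial a b (\<rho> / 2 ^ n) (F j) i x
    = - (kernel_conv a b (dyadic_field_partial j i) (\<rho> / 2 ^ n) h x /\<^sub>R (\<rho> / 2 ^ n) ^ 3)"
proof -
  have "\<rho> / 2 ^ Suc n = \<rho> / 2 ^ n / 2" by simp
  then show ?thesis
    using moll_partial_step[OF radius_bounds assms, of n j i] by (metis minus_diff_eq)
qed

lemma kernels_continuous:
  "continuous_on UNIV (bump_partial i)" "continuous_on UNIV (dyadic_field j)"
  "continuous_on UNIV (dyadic_field_partial j i)"
  by (rule has_partials_on_continuous_partial[OF has_partials_on_bump]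
    has_partials_on_continuous[OF has_partials_on_dyadic_field]
    has_partials_on_continuous_partial[OF has_partials_on_dyadic_field])+

text \<open>At scale \<open>\<rho> / 2 ^ n\<close> the mollification is within a multiple of
  \<open>2 ^ (-n)\<close> of \<open>m * F j\<close>, while its Lipschitz constant grows linearly in
  \<open>n\<close>, as each halving adds a bounded amount to the partials. Comparing points at the
  distance of the scale gives the bound.\<close>

lemma gradient_dyadic_modulus:
  "\<exists>K\<ge>0. \<forall>n j x y. dist x0 x < \<rho> \<longrightarrow> dist x0 y < \<rho> \<longrightarrow> dist x y \<le> \<rho> / 2 ^ n \<longrightarrow>
    norm (F j x - F j y) \<le> K * (real (Suc n) / 2 ^ n)"
proof -
  obtain C where C: "C > 0" "\<And>i z. \<bar>bump_partial i z\<bar> \<le> C"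
    "\<And>j z. \<bar>dyadic_field j z\<bar> \<le> C" "\<And>j i z. \<bar>dyadic_field_partial j i z\<bar> \<le> C"
    using kernels_bounded by blast
  obtain m where m: "m > 0" "\<And>n x. dist x0 x < \<rho> \<Longrightarrow> moll a b (\<rho> / 2 ^ n) (\<lambda>_. 1) x = complex_of_real m"
    using moll_mass by blast
  have bd: "\<exists>M\<ge>0. \<forall>y\<in>cbox a b. norm (G y) \<le> M" if "continuous_on (cbox a b) G" for G :: "real ^ 3 \<Rightarrow> complex"
  proof -
    have "bounded (G ` cbox a b)" using compact_imp_bounded[OF compact_continuous_image[OF that compact_cbox]] .
    then show ?thesis unfolding bounded_pos by (auto intro: less_imp_le)
  qed
  obtain Mh where Mh: "Mh \<ge> 0" "\<And>y. y \<in> cbox a b \<Longrightarrow> norm (h y) \<le> Mh" using bd[OF continuous_on_source] by blast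
  obtain MF where MF: "\<And>j. MF j \<ge> 0" "\<And>j y. y \<in> cbox a b \<Longrightarrow> norm (F j y) \<le> MF j" using bd[OF continuous_on_gradient] by metis
  define M where "M = Mh + (\<Sum>j\<in>UNIV. MF j)"
  have M: "M \<ge> 0" using Mh MF by (simp add: M_def sum_nonneg)
  have hM: "norm (h y) \<le> M" if "y \<in> cbox a b" for y
    using Mh(2)[OF that] sum_nonneg[of UNIV MF] MF(1) by (simp add: M_def)
  have FM: "norm (F j y) \<le> M" if "y \<in> cbox a b" for j y
  proof -
    have "MF j \<le> (\<Sum>j\<in>UNIV. MF j)" using MF(1) by (intro member_le_sum) auto
    then show ?thesis using MF(2)[OF that, of j] Mh(1) by (simp add: M_def)
  qed
  define A where "A = 8 * C * M"
  have A: "A \<ge> 0" using C(1) M by (simp add: A_def)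
  \<comment> \<open>\<open>A / \<rho>\<close> bounds the partials at the first scale and
    \<open>A\<close> each later increment; \<open>E\<close> dominates both.\<close>
  define E where "E = A * (1 + 1 / \<rho>)"
  have E: "A \<le> E" "A / \<rho> \<le> E" "E \<ge> 0" using A \<rho>(1) by (auto simp: E_def field_simps)
  have step: "norm (moll a b (\<rho> / 2 ^ Suc n) (F j) x - moll a b (\<rho> / 2 ^ n) (F j) x) \<le> A * (\<rho> / 2 ^ n)"
    if x: "dist x0 x < \<rho>" for n j x
  proof -
    have "norm (kernel_conv a b (dyadic_field j) (\<rho> / 2 ^ n) h x /\<^sub>R (\<rho> / 2 ^ n) ^ 3) \<le> A"
      unfolding A_def
      by (rule norm_conv_scaled_le[OF kernels_continuous(2) C(3) kernels_eq_0(3) radius_bounds(1) continuous_on_source hM M])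
    then show ?thesis unfolding moll_Suc_step[OF x] norm_minus_cancel
      by (subst norm_scaleR) (use \<rho>(1) in \<open>simp add: divide_right_mono mult.commute mult_left_mono\<close>)
  qed
  have partial_bound: "norm (moll_partial a b (\<rho> / 2 ^ n) (F j) i x) \<le> E * real (Suc n)"
    if x: "dist x0 x < \<rho>" for n j i x
  proof (induction n)
    case 0
    have "norm (kernel_conv a b (bump_partial i) \<rho> (F j) x /\<^sub>R \<rho> ^ 3) \<le> A"
      unfolding A_def
      by (rule norm_conv_scaled_le[OF kernels_continuous(1) C(2) kernels_eq_0(2) \<rho>(1) continuous_on_gradient FM M])
    moreover have "moll_partial a b \<rho> (F j) i x = (1 / \<rho>) *\<^sub>R (kernel_conv a b (bump_partial i) \<rho> (F j) x /\<^sub>R \<rho> ^ 3)"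
      by (simp add: moll_partial_def divide_inverse power_Suc numeral_eq_Suc mult_ac)
    ultimately have "norm (moll_partial a b \<rho> (F j) i x) \<le> A / \<rho>"
      using \<rho>(1) by (simp only: norm_scaleR) (simp add: divide_right_mono)
    then show ?case using E(2) by simp
  next
    case (Suc n)
    have "norm (kernel_conv a b (dyadic_field_partial j i) (\<rho> / 2 ^ n) h x /\<^sub>R (\<rho> / 2 ^ n) ^ 3) \<le> A"
      unfolding A_def
      by (rule norm_conv_scaled_le[OF kernels_continuous(3) C(4) kernels_eq_0(4) radius_bounds(1) continuous_on_source hM M])
    then have "norm (moll_partial a b (\<rho> / 2 ^ Suc n) (F j) i x - moll_partial a b (\<rho> / 2 ^ n) (F j) i x) \<le> E"
      unfolding moll_partial_Suc_step[OF x] norm_minus_cancel using E(1) by linarith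
    then have "norm (moll_partial a b (\<rho> / 2 ^ Suc n) (F j) i x) \<le> E + E * real (Suc n)"
      using Suc.IH norm_triangle_sub[of "moll_partial a b (\<rho> / 2 ^ Suc n) (F j) i x" "moll_partial a b (\<rho> / 2 ^ n) (F j) i x"]
      by linarith
    then show ?case by (simp add: algebra_simps)
  qed
  have lip: "norm (moll a b (\<rho> / 2 ^ n) (F j) x - moll a b (\<rho> / 2 ^ n) (F j) y) \<le> 3 * (E * real (Suc n)) * norm (x - y)"
    if "dist x0 x < \<rho>" "dist x0 y < \<rho>" for n j x y
  proof (rule differentiable_bound[of "ball x0 \<rho>"])
    fix z assume z: "z \<in> ball x0 \<rho>"
    show "(moll a b (\<rho> / 2 ^ n) (F j) has_derivative
        (\<lambda>v. \<Sum>i\<in>UNIV. v $ i *\<^sub>R moll_partial a b (\<rho> / 2 ^ n) (F j) i z)) (at z within ball x0 \<rho>)"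
      by (rule has_derivative_at_withinI[OF moll_has_derivative[OF continuous_on_gradient]])
    show "onorm (\<lambda>v::real^3. \<Sum>i\<in>UNIV. v $ i *\<^sub>R moll_partial a b (\<rho> / 2 ^ n) (F j) i z) \<le> 3 * (E * real (Suc n))"
      by (intro onorm_le norm_sum_partials_le partial_bound) (use z in simp)
  qed (use that in auto)
  \<comment> \<open>Two tails \<open>2 * A * \<rho>\<close> and the Lipschitz term
    \<open>3 * E * \<rho>\<close>, divided by the mass of the bump.\<close>
  define K where "K = (4 * A * \<rho> + 3 * E * \<rho>) / m"
  have K: "K \<ge> 0" using A E \<rho> m by (simp add: K_def)
  have "norm (F j x - F j y) \<le> K * (real (Suc n) / 2 ^ n)"
    if x: "dist x0 x < \<rho>" and y: "dist x0 y < \<rho>" and xy: "dist x y \<le> \<rho> / 2 ^ n" for n j x y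
  proof -
    let ?f = "\<lambda>x. moll a b (\<rho> / 2 ^ n) (F j) x"
    have tail: "norm (m * F j z - ?f z) \<le> 2 * A * (\<rho> / 2 ^ n)" if "dist x0 z < \<rho>" for z
      by (rule dyadic_tail_le[OF moll_tendsto[OF m(2) continuous_on_gradient that] step[OF that]])
    have "norm (?f x - ?f y) \<le> 3 * (E * real (Suc n)) * (\<rho> / 2 ^ n)"
      using lip[OF x y, of n j] xy E(3)
      by (smt (verit) dist_norm mult_left_mono mult_nonneg_nonneg of_nat_0_le_iff)
    moreover have "m * norm (F j x - F j y) \<le> norm (m * F j x - ?f x) + norm (?f x - ?f y) + norm (m * F j y - ?f y)"
    proof -
      have "m * norm (F j x - F j y) = norm (m * F j x - m * F j y)"
        using m(1) by (simp add: right_diff_distrib[symmetric] norm_mult)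
      also have "m * F j x - m * F j y = (m * F j x - ?f x) + (?f x - ?f y) - (m * F j y - ?f y)" by simp
      also have "norm \<dots> \<le> norm (m * F j x - ?f x) + norm (?f x - ?f y) + norm (m * F j y - ?f y)"
        by (rule order_trans[OF norm_triangle_ineq4 add_right_mono[OF norm_triangle_ineq]])
      finally show ?thesis .
    qed
    ultimately have "m * norm (F j x - F j y) \<le> 4 * A * (\<rho> / 2 ^ n) + 3 * (E * real (Suc n)) * (\<rho> / 2 ^ n)"
      using tail[OF x] tail[OF y] by linarith
    also have "4 * A * (\<rho> / 2 ^ n) \<le> 4 * A * (\<rho> / 2 ^ n) * real (Suc n)"
      using mult_left_mono[of 1 "real (Suc n)" "4 * A * (\<rho> / 2 ^ n)"] A \<rho>(1) by simp
    finally have "m * norm (F j x - F j y) \<le> (4 * A * \<rho> + 3 * E * \<rho>) * (real (Suc n) / 2 ^ n)"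
      by (simp add: algebra_simps add_divide_distrib)
    then show ?thesis using m(1) by (simp add: K_def field_simps)
  qed
  with K show ?thesis by blast
qed

text \<open>The source is Lipschitz in position and gradient, so it inherits the modulus of the
  gradient. The partials of the mollifications then converge uniformly, and the limit can be
  differentiated through them. Symmetry and trace of the Jacobian survive the limit.\<close>

lemma gradient_regularity:
  assumes L: "\<And>x y. dist x0 x < \<rho> \<Longrightarrow> dist x0 y < \<rho> \<Longrightarrow>
      norm (h x - h y) \<le> L * (dist x y + (\<Sum>j\<in>UNIV. norm (F j x - F j y)))" "L \<ge> 0"
  shows "\<exists>F'. (\<forall>j. (F j has_derivative (\<lambda>v. \<Sum>i\<in>UNIV. v $ i *\<^sub>R F' j i)) (at x0)) \<and>
    (\<forall>i j. F' j i = F' i j) \<and> (\<Sum>j\<in>UNIV. F' j j) = h x0"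
proof -
  obtain C where C: "C > 0" "\<And>j i z. \<bar>dyadic_field_partial j i z\<bar> \<le> C"
    using kernels_bounded by blast
  obtain m where m: "m > 0" "\<And>n x. dist x0 x < \<rho> \<Longrightarrow> moll a b (\<rho> / 2 ^ n) (\<lambda>_. 1) x = complex_of_real m"
    using moll_mass by blast
  obtain K where K: "K \<ge> 0" "\<And>n j x y. \<lbrakk>dist x0 x < \<rho>; dist x0 y < \<rho>; dist x y \<le> \<rho> / 2 ^ n\<rbrakk> \<Longrightarrow>
    norm (F j x - F j y) \<le> K * (real (Suc n) / 2 ^ n)"
    using gradient_dyadic_modulus by blast
  \<comment> \<open>The distance contributes \<rho>, and each of the three gradient components
    contributes \<open>K\<close>.\<close>
  define E where "E = L * (\<rho> + 3 * K)"
  have E: "E \<ge> 0" using L(2) K(1) \<rho>(1) by (simp add: E_def)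
  have modulus: "norm (h y - h x) \<le> E * (real (n + 2) / 2 ^ Suc n)"
    if "dist x0 x < \<rho>" "dist x0 y < \<rho>" "dist x y \<le> \<rho> / 2 ^ Suc n" for x y n
  proof -
    have "norm (h y - h x) \<le> L * (dist x y + (\<Sum>j\<in>UNIV. norm (F j x - F j y)))"
      using L(1)[OF that(1,2)] by (simp add: norm_minus_commute)
    also have "\<dots> \<le> L * (\<rho> * (real (n + 2) / 2 ^ Suc n) + (\<Sum>j\<in>(UNIV::3 set). K * (real (n + 2) / 2 ^ Suc n)))"
    proof (intro mult_left_mono add_mono sum_mono L(2))
      have "\<rho> / 2 ^ Suc n \<le> \<rho> * (real (n + 2) / 2 ^ Suc n)" using \<rho>(1) by (simp add: field_simps)
      then show "dist x y \<le> \<rho> * (real (n + 2) / 2 ^ Suc n)" using that(3) by linarith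
      show "norm (F j x - F j y) \<le> K * (real (n + 2) / 2 ^ Suc n)" for j
        using K(2)[OF that, of j] by simp
    qed
    also have "\<dots> = E * (real (n + 2) / 2 ^ Suc n)" by (simp add: E_def algebra_simps add_divide_distrib)
    finally show ?thesis .
  qed
  \<comment> \<open>From the half ball, kernels of radius at most \<open>\<rho> / 2\<close> reach
    only points within \<rho> of \<open>x0\<close>, where \<open>modulus\<close> holds. Hence the
    sequences below start at index \<open>Suc 0\<close>.\<close>
  let ?S = "ball x0 (\<rho> / 2)"
  define D where "D n j i x = moll_partial a b (\<rho> / 2 ^ n) (F j) i x" for n j i x
  have Dstep: "norm (D (Suc (Suc n)) j i x - D (Suc n) j i x) \<le> (8 * C * E) * (real (n + 2) / 2 ^ Suc n)"
    if x: "x \<in> ?S" for n j i x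
  proof -
    let ?s = "\<rho> / 2 ^ Suc n"
    have s: "?s \<le> \<rho> / 2" using \<rho>(1) by (simp add: field_simps)
    have x': "dist x0 x < \<rho>" using x \<rho>(1) by simp
    have continuous_on_source': "continuous_on (cbox a b) (\<lambda>y. h y - h x)" by (intro continuous_intros continuous_on_source)
    \<comment> \<open>Mean zero of the kernel allows replacing \<open>h\<close> by
      \<open>h - h x\<close>, which \<open>modulus\<close> makes small on the support.\<close>
    have "kernel_conv a b (dyadic_field_partial j i) ?s (\<lambda>_. h x) x = 0"
      by (rule kernel_conv_partial_const_eq_0[OF has_partials_on_dyadic_field kernels_eq_0(3) radius_bounds(1) ball_in_box])
        (assumption, simp add: less_imp_le[OF x'], rule radius_bounds(2))
    then have e: "kernel_conv a b (dyadic_field_partial j i) ?s h x = kernel_conv a b (dyadic_field_partial j i) ?s (\<lambda>y. h y - h x) x"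
      using kernel_conv_diff[OF kernels_continuous(3) continuous_on_source, of "\<lambda>_. h x" j i ?s x] by simp
    have "norm (D (Suc (Suc n)) j i x - D (Suc n) j i x) = norm (kernel_conv a b (dyadic_field_partial j i) ?s (\<lambda>y. h y - h x) x /\<^sub>R ?s ^ 3)"
      unfolding D_def moll_partial_Suc_step[OF x'] norm_minus_cancel e ..
    also have "\<dots> \<le> 8 * C * (E * (real (n + 2) / 2 ^ Suc n))"
    proof (rule norm_conv_scaled_le[OF kernels_continuous(3) C(2) kernels_eq_0(4) radius_bounds(1) continuous_on_source'])
      fix y assume y: "dist x y \<le> ?s"
      have "dist x0 y < \<rho>" using dist_triangle[of x0 y x] y s x by simp
      then show "norm (h y - h x) \<le> E * (real (n + 2) / 2 ^ Suc n)" by (rule modulus[OF x' _ y])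
    qed (use E in simp_all)
    finally show ?thesis by simp
  qed
  \<comment> \<open>The limit is written as a telescoping series so that the Weierstrass test gives
    uniform convergence on the half ball.\<close>
  define l where "l j i x = (\<Sum>n. D (Suc (Suc n)) j i x - D (Suc n) j i x) + D (Suc 0) j i x" for j i x
  have ul: "uniform_limit ?S (\<lambda>n. D (Suc n) j i) (l j i) sequentially" for j i
  proof -
    have "uniform_limit ?S (\<lambda>n x. \<Sum>k<n. D (Suc (Suc k)) j i x - D (Suc k) j i x)
      (\<lambda>x. \<Sum>n. D (Suc (Suc n)) j i x - D (Suc n) j i x) sequentially"
      by (rule Weierstrass_m_test[OF Dstep summable_mult[OF summable_linear_times_geometric]])
    then have "uniform_limit ?S (\<lambda>n x. (\<Sum>k<n. D (Suc (Suc k)) j i x - D (Suc k) j i x) + D (Suc 0) j i x)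
      (\<lambda>x. (\<Sum>n. D (Suc (Suc n)) j i x - D (Suc n) j i x) + D (Suc 0) j i x) sequentially"
      by (intro uniform_limit_add uniform_limit_const)
    moreover have "(\<Sum>k<n. D (Suc (Suc k)) j i x - D (Suc k) j i x) + D (Suc 0) j i x = D (Suc n) j i x" for n x
      using sum_lessThan_telescope[of "\<lambda>k. D (Suc k) j i x" n] by simp
    ultimately show ?thesis by (simp add: l_def[abs_def])
  qed
  have x0S: "x0 \<in> ?S" using \<rho>(1) by simp
  have lim: "(\<lambda>n. D (Suc n) j i x0) \<longlonglongrightarrow> l j i x0" for j i
    by (rule tendsto_uniform_limitI[OF ul x0S])
  have lim_f: "(\<lambda>n. moll a b (\<rho> / 2 ^ Suc n) G x) \<longlonglongrightarrow> m * G x"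
    if "dist x0 x < \<rho>" "continuous_on (cbox a b) G" for G :: "real ^ 3 \<Rightarrow> complex" and x
  proof -
    have "(\<lambda>n. moll a b (\<rho> / 2 ^ n) G x) \<longlonglongrightarrow> m * G x"
      by (rule moll_tendsto) (use m(2) that in auto)
    then show ?thesis by (rule LIMSEQ_Suc)
  qed
  \<comment> \<open>The mollifications converge to \<open>m * F j\<close> and their derivatives
    uniformly to \<open>l\<close>, so \<open>l\<close> is the derivative of the limit; dividing by
    \<open>m\<close> gives that of \<open>F j\<close>.\<close>
  have der: "(F j has_derivative (\<lambda>v. \<Sum>i\<in>UNIV. v $ i *\<^sub>R (l j i x0 / m))) (at x0)" for j
  proof -
    have "\<exists>g. \<forall>x\<in>?S. (\<lambda>n. moll a b (\<rho> / 2 ^ Suc n) (F j) x) \<longlonglongrightarrow> g x \<and>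
      (g has_derivative (\<lambda>v. \<Sum>i\<in>UNIV. v $ i *\<^sub>R l j i x)) (at x within ?S)"
    proof (rule has_derivative_sequence[OF convex_ball _ _ x0S lim_f[OF _ continuous_on_gradient]])
      show "dist x0 x0 < \<rho>" using \<rho>(1) by simp
      show "(moll a b (\<rho> / 2 ^ Suc n) (F j) has_derivative (\<lambda>v. \<Sum>i\<in>UNIV. v $ i *\<^sub>R D (Suc n) j i x)) (at x within ?S)" for n x
        unfolding D_def by (rule has_derivative_at_withinI[OF moll_has_derivative[OF continuous_on_gradient]])
      fix e :: real assume e: "e > 0"
      have "\<forall>\<^sub>F n in sequentially. \<forall>x\<in>?S. dist (D (Suc n) j i x) (l j i x) < e / 3" for i
        by (rule uniform_limitD[OF ul]) (use e in simp)
      then have "\<forall>\<^sub>F n in sequentially. \<forall>i. \<forall>x\<in>?S. dist (D (Suc n) j i x) (l j i x) < e / 3"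
        by (rule eventually_all_finite)
      then show "\<forall>\<^sub>F n in sequentially. \<forall>x\<in>?S. \<forall>v. norm ((\<Sum>i\<in>UNIV. v $ i *\<^sub>R D (Suc n) j i x) -
          (\<Sum>i\<in>UNIV. v $ i *\<^sub>R l j i x)) \<le> e * norm v"
      proof eventually_elim
        case (elim n)
        show ?case
        proof (intro ballI allI)
          fix x and v :: "real ^ 3" assume x: "x \<in> ?S"
          have "norm (\<Sum>i\<in>UNIV. v $ i *\<^sub>R (D (Suc n) j i x - l j i x)) \<le> 3 * (e / 3) * norm v"
            by (rule norm_sum_partials_le) (use elim x in \<open>auto simp: dist_norm intro: less_imp_le\<close>)
          then show "norm ((\<Sum>i\<in>UNIV. v $ i *\<^sub>R D (Suc n) j i x) - (\<Sum>i\<in>UNIV. v $ i *\<^sub>R l j i x)) \<le> e * norm v"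
            by (simp add: scaleR_diff_right sum_subtractf)
        qed
      qed
    qed
    then obtain g where g: "\<And>x. x \<in> ?S \<Longrightarrow> (\<lambda>n. moll a b (\<rho> / 2 ^ Suc n) (F j) x) \<longlonglongrightarrow> g x"
      "(g has_derivative (\<lambda>v. \<Sum>i\<in>UNIV. v $ i *\<^sub>R l j i x0)) (at x0 within ?S)" using x0S by blast
    have gF: "g x = m * F j x" if "x \<in> ?S" for x
      using LIMSEQ_unique[OF g(1)[OF that] lim_f[OF _ continuous_on_gradient]] that \<rho>(1) by simp
    have "(g has_derivative (\<lambda>v. \<Sum>i\<in>UNIV. v $ i *\<^sub>R l j i x0)) (at x0)"
      using g(2) at_within_open[OF x0S open_ball] by simp
    then have "((\<lambda>x. m * F j x) has_derivative (\<lambda>v. \<Sum>i\<in>UNIV. v $ i *\<^sub>R l j i x0)) (at x0)"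
      by (rule has_derivative_transform_within_open[OF _ open_ball x0S gF])
    from has_derivative_mult_right[OF this, of "1 / m"]
    have "((\<lambda>x. (1 / complex_of_real m) * (m * F j x)) has_derivative (\<lambda>v. (1 / complex_of_real m) * (\<Sum>i\<in>UNIV. v $ i *\<^sub>R l j i x0))) (at x0)"
      by simp
    moreover have "(\<lambda>x. (1 / complex_of_real m) * (m * F j x)) = F j" using m(1) by auto
    moreover have "(\<lambda>v::real^3. (1 / complex_of_real m) * (\<Sum>i\<in>UNIV. v $ i *\<^sub>R l j i x0)) = (\<lambda>v. \<Sum>i\<in>UNIV. v $ i *\<^sub>R (l j i x0 / m))"
      by (simp add: fun_eq_iff sum_divide_distrib scaleR_conv_of_real[where 'a = complex])
    ultimately show ?thesis by simp
  qed
  have sym: "l j i x0 = l i j x0" for i j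
  proof -
    have "D n j i x0 = D n i j x0" for n
      unfolding D_def by (rule moll_partial_sym[OF radius_bounds(1) ball_in_box]) (use \<rho>(1) radius_bounds(2) in auto)
    then show ?thesis using LIMSEQ_unique[OF lim[of j i]] lim[of i j] by simp
  qed
  \<comment> \<open>The traces of the mollified Jacobians are mollifications of \<open>h\<close>,
    which tend to \<open>m * h x0\<close>.\<close>
  have "(\<lambda>n. \<Sum>j\<in>UNIV. D (Suc n) j j x0) \<longlonglongrightarrow> (\<Sum>j\<in>UNIV. l j j x0)"
    by (intro tendsto_sum lim)
  moreover have "(\<Sum>j\<in>UNIV. D (Suc n) j j x0) = moll a b (\<rho> / 2 ^ Suc n) h x0" for n
    unfolding D_def
    by (rule moll_partial_div[OF radius_bounds(1) ball_in_box]) (simp add: less_imp_le[OF \<rho>(1)], rule radius_bounds(2))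
  ultimately have "(\<Sum>j\<in>UNIV. l j j x0) = m * h x0"
    using LIMSEQ_unique[OF _ lim_f[OF _ continuous_on_source, of x0]] \<rho>(1) by simp
  then have "(\<Sum>j\<in>UNIV. l j j x0 / m) = h x0" using m(1) by (simp add: sum_divide_distrib[symmetric])
  with der sym show ?thesis by (intro exI[of _ "\<lambda>j i. l j i x0 / m"]) auto
qed

end

section \<open>Regularity of the gradient\<close>

lemma has_partials_on_lipschitz:
  fixes p :: "real ^ 3 \<Rightarrow> complex"
  assumes p: "has_partials_on p P S" and S: "cball x0 r \<subseteq> S"
  shows "\<exists>\<Lambda>\<ge>0. \<forall>x\<in>cball x0 r. \<forall>y\<in>cball x0 r. norm (p x - p y) \<le> \<Lambda> * dist x y"
proof -
  have "bounded (P i ` cball x0 r)" for i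
    using has_partials_on_continuous_partial[OF p] S
    by (intro compact_imp_bounded compact_continuous_image) (auto intro: continuous_on_subset)
  then have "\<exists>B>0. \<forall>x\<in>cball x0 r. norm (P i x) \<le> B" for i unfolding bounded_pos by auto
  then obtain B where B: "\<And>i. B i > 0" "\<And>i x. x \<in> cball x0 r \<Longrightarrow> norm (P i x) \<le> B i" by metis
  define C where "C = (\<Sum>i\<in>UNIV. B i)"
  have C0: "C \<ge> 0" using less_imp_le[OF B(1)] by (simp add: C_def sum_nonneg)
  have "B i \<le> C" for i unfolding C_def using less_imp_le[OF B(1)] by (auto intro: member_le_sum)
  then have C: "norm (P i x) \<le> C" if "x \<in> cball x0 r" for i x using B(2)[OF that] order_trans by blast
  have "norm (p x - p y) \<le> 3 * C * norm (x - y)" if xy: "x \<in> cball x0 r" "y \<in> cball x0 r" for x y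
  proof (rule differentiable_bound[OF convex_cball _ _ xy])
    fix z assume z: "z \<in> cball x0 r"
    show "(p has_derivative (\<lambda>v. \<Sum>i\<in>UNIV. v $ i *\<^sub>R P i z)) (at z within cball x0 r)"
      by (rule has_derivative_at_withinI[OF has_partials_on_derivative[OF p]]) (use z S in auto)
    show "onorm (\<lambda>v::real^3. \<Sum>i\<in>UNIV. v $ i *\<^sub>R P i z) \<le> 3 * C"
      by (intro onorm_le norm_sum_partials_le C z)
  qed
  then show ?thesis using C0 by (intro exI[of _ "3 * C"]) (auto simp: dist_norm)
qed

text \<open>\<open>f\<^sup>2 \<nabla>u\<close> is a curl, hence weakly divergence free; test this with \<open>\<eta> / f\<^sup>2\<close>.\<close>

lemma weak_poisson_of_curl:
  fixes u f :: "real ^ 3 \<Rightarrow> complex" and v :: "3 \<Rightarrow> real ^ 3 \<Rightarrow> complex"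
  assumes S: "open S" "cbox a b \<subseteq> S"
    and u: "has_partials_on u F S" and f: "has_partials_on f f' S" and nz: "\<And>x. x \<in> S \<Longrightarrow> f x \<noteq> 0"
    and v: "\<And>i. has_partials_on (v i) (V i) S"
    and curl: "\<And>x. x \<in> S \<Longrightarrow> f x * f x * F 1 x = V 2 3 x - V 3 2 x"
      "\<And>x. x \<in> S \<Longrightarrow> f x * f x * F 2 x = V 3 1 x - V 1 3 x"
      "\<And>x. x \<in> S \<Longrightarrow> f x * f x * F 3 x = V 1 2 x - V 2 1 x"
    and e: "has_partials_on \<eta> H S" and K: "compact K" "K \<subseteq> box a b"
      "\<And>y. y \<notin> K \<Longrightarrow> \<eta> y = 0" "\<And>i y. y \<notin> K \<Longrightarrow> H i y = 0"
  shows "integral (cbox a b) (\<lambda>y. \<Sum>i\<in>UNIV. F i y * H i y) =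
    - integral (cbox a b) (\<lambda>y. - 2 * (\<Sum>i\<in>UNIV. F i y * f' i y) / f y * \<eta> y)"
proof -
  let ?B = "cbox a b"
  define A where "A i x = f x * f' i x + f' i x * f x" for i x
  have ff: "has_partials_on (\<lambda>x. f x * f x) A S"
    using has_partials_on_mult[OF f f] by (simp add: A_def[abs_def])
  \<comment> \<open>The gradient of the test function \<open>\<eta> / f\<^sup>2\<close>, by the
    quotient rule.\<close>
  define Z where "Z i x = H i x / (f x * f x) - \<eta> x * A i x / ((f x * f x) * (f x * f x))" for i x
  have z: "has_partials_on (\<lambda>x. \<eta> x / (f x * f x)) Z S"
    unfolding Z_def[abs_def] using has_partials_on_divide[OF e ff] nz by simp
  have c: "continuous_on ?B (F i)" "continuous_on ?B (V j i)" "continuous_on ?B (Z i)" "continuous_on ?B (H i)"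
    "continuous_on ?B (f' i)" "continuous_on ?B f" "continuous_on ?B \<eta>" for i j
    using has_partials_on_continuous_partial[OF u] has_partials_on_continuous_partial[OF v]
      has_partials_on_continuous_partial[OF z] has_partials_on_continuous_partial[OF e]
      has_partials_on_continuous_partial[OF f] has_partials_on_continuous[OF f] has_partials_on_continuous[OF e]
    by (auto intro: continuous_on_subset[OF _ S(2)])
  have sw: "integral ?B (\<lambda>y. V j i y * Z k y - V j k y * Z i y) = 0" for i j k
  proof -
    have "integral ?B (\<lambda>y. V j i y * Z k y) = integral ?B (\<lambda>y. V j k y * Z i y)"
      by (rule integral_partials_swap[OF S v z K(1,2)]) (simp_all add: K Z_def)
    then show ?thesis
      by (subst integral_diff) (auto intro!: integrable_continuous continuous_intros c)
  qed
  have i2: "(\<lambda>y. V j i y * Z k y - V j k y * Z i y) integrable_on ?B" for i j k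
    by (intro integrable_continuous continuous_intros c)
  \<comment> \<open>The six terms are grouped by the component of \<open>v\<close>, so that each
    pair integrates to zero by \<open>sw\<close>. Regrouping them by the component of
    \<open>Z\<close> in \<open>pt\<close> makes the curl appear.\<close>
  have i0: "integral ?B (\<lambda>y. (V 2 3 y * Z 1 y - V 2 1 y * Z 3 y) + (V 3 1 y * Z 2 y - V 3 2 y * Z 1 y) + (V 1 2 y * Z 3 y - V 1 3 y * Z 2 y)) = 0"
    by (subst integral_add, intro integrable_add i2, rule i2, subst integral_add, rule i2, rule i2, simp only: sw) simp
  have pt: "(V 2 3 y * Z 1 y - V 2 1 y * Z 3 y) + (V 3 1 y * Z 2 y - V 3 2 y * Z 1 y) + (V 1 2 y * Z 3 y - V 1 3 y * Z 2 y)
      = (\<Sum>i\<in>UNIV. F i y * H i y) - 2 * (\<Sum>i\<in>UNIV. F i y * f' i y) / f y * \<eta> y" if y: "y \<in> ?B" for y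
  proof -
    have yS: "y \<in> S" using y S(2) by blast
    have "(V 2 3 y * Z 1 y - V 2 1 y * Z 3 y) + (V 3 1 y * Z 2 y - V 3 2 y * Z 1 y) + (V 1 2 y * Z 3 y - V 1 3 y * Z 2 y)
      = (V 2 3 y - V 3 2 y) * Z 1 y + (V 3 1 y - V 1 3 y) * Z 2 y + (V 1 2 y - V 2 1 y) * Z 3 y"
      by (simp add: algebra_simps)
    also have "\<dots> = (\<Sum>i\<in>UNIV. F i y * (f y * f y * Z i y))"
      unfolding curl[OF yS, symmetric] by (simp add: sum_3 algebra_simps)
    also have "(\<lambda>i. f y * f y * Z i y) = (\<lambda>i. H i y - 2 * f' i y / f y * \<eta> y)"
    proof
      fix i
      have "f y * f y * Z i y = H i y - \<eta> y * (A i y / (f y * f y))"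
        using nz[OF yS] by (simp add: Z_def right_diff_distrib)
      also have "A i y / (f y * f y) = 2 * f' i y / f y"
        using nz[OF yS] by (simp add: A_def)
      finally show "f y * f y * Z i y = H i y - 2 * f' i y / f y * \<eta> y" by simp
    qed
    finally show ?thesis by (simp add: sum_3 algebra_simps add_divide_distrib)
  qed
  have "integral ?B (\<lambda>y. (\<Sum>i\<in>UNIV. F i y * H i y) - 2 * (\<Sum>i\<in>UNIV. F i y * f' i y) / f y * \<eta> y) = 0"
    by (rule trans[OF integral_cong[OF pt[symmetric]] i0])
  moreover have "(\<lambda>y. \<Sum>i\<in>UNIV. F i y * H i y) integrable_on ?B"
    by (intro integrable_continuous continuous_intros c)
  moreover have "(\<lambda>y. 2 * (\<Sum>i\<in>UNIV. F i y * f' i y) / f y * \<eta> y) integrable_on ?B"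
    by (intro integrable_continuous continuous_intros c) (use nz S(2) in auto)
  ultimately have "integral ?B (\<lambda>y. \<Sum>i\<in>UNIV. F i y * H i y) = integral ?B (\<lambda>y. 2 * (\<Sum>i\<in>UNIV. F i y * f' i y) / f y * \<eta> y)"
    by (simp only: integral_diff right_minus_eq)
  then show ?thesis by simp
qed

text \<open>With \<open>p\<close> the gradient of \<open>f\<close> divided by \<open>f\<close>, the
  source is -2 times the dot product of \<open>F\<close> and \<open>p\<close>. As the partials of
  \<open>f\<close> are continuously differentiable, \<open>p\<close> is Lipschitz near
  \<open>x0\<close>, which gives the Lipschitz condition of
  \<open>gradient_regularity\<close>.\<close>

lemma weighted_curl_gradient_regularity:
  fixes u f :: "real ^ 3 \<Rightarrow> complex" and v :: "3 \<Rightarrow> real ^ 3 \<Rightarrow> complex"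
  assumes S: "open S" "x0 \<in> S"
    and u: "has_partials_on u F S" and f: "has_partials_on f f' S" and nz: "\<And>x. x \<in> S \<Longrightarrow> f x \<noteq> 0"
    and f2: "\<And>i. has_partials_on (f' i) (f'' i) S"
    and v: "\<And>i. has_partials_on (v i) (V i) S"
    and curl: "\<And>x. x \<in> S \<Longrightarrow> f x * f x * F 1 x = V 2 3 x - V 3 2 x"
      "\<And>x. x \<in> S \<Longrightarrow> f x * f x * F 2 x = V 3 1 x - V 1 3 x"
      "\<And>x. x \<in> S \<Longrightarrow> f x * f x * F 3 x = V 1 2 x - V 2 1 x"
  shows "\<exists>F'. (\<forall>j. (F j has_derivative (\<lambda>v. \<Sum>i\<in>UNIV. v $ i *\<^sub>R F' j i)) (at x0)) \<and>
    (\<forall>i j. F' j i = F' i j) \<and> (\<Sum>j\<in>UNIV. F' j j) = - 2 * (\<Sum>i\<in>UNIV. F i x0 * f' i x0) / f x0"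
proof -
  obtain a b where ab: "cbox a b \<subseteq> S" "x0 \<in> box a b" "\<forall>i\<in>Basis. a \<bullet> i < b \<bullet> i"
    by (rule open_contains_cbox[OF S])
  obtain r where r: "r > 0" "cball x0 r \<subseteq> box a b"
    using open_contains_cball[of "box a b"] open_box ab(2) by blast
  define \<rho> where "\<rho> = r / 2"
  define h where "h y = - 2 * (\<Sum>i\<in>UNIV. F i y * f' i y) / f y" for y
  define p where "p i y = f' i y / f y" for i y
  have cS: "continuous_on S (F i)" "continuous_on S (f' i)" "continuous_on S f" for i
    using has_partials_on_continuous_partial[OF u] has_partials_on_continuous_partial[OF f]
      has_partials_on_continuous[OF f] by auto
  interpret weak_poisson S a b u h F x0 \<rho>
  proof
    show "continuous_on S h" unfolding h_def by (intro continuous_intros cS) (use nz in auto)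
    show "\<rho> > 0" "cball x0 (2 * \<rho>) \<subseteq> box a b" using r by (auto simp: \<rho>_def)
  qed (use S ab u weak_poisson_of_curl[OF S(1) ab(1) u f nz v curl] in \<open>auto simp: h_def\<close>)
  have "cball x0 \<rho> \<subseteq> cball x0 r" using r(1) by (simp add: \<rho>_def subset_cball)
  then have \<rho>S: "cball x0 \<rho> \<subseteq> S" using r(2) ab(1) box_subset_cbox[of a b] by blast
  have "\<exists>\<Lambda>\<ge>0. \<forall>x\<in>cball x0 \<rho>. \<forall>y\<in>cball x0 \<rho>. norm (p i x - p i y) \<le> \<Lambda> * dist x y" for i
    unfolding p_def by (rule has_partials_on_lipschitz[OF has_partials_on_divide[OF f2 f nz] \<rho>S])
  then obtain \<Lambda> where \<Lambda>: "\<And>i. \<Lambda> i \<ge> 0"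
    "\<And>i x y. x \<in> cball x0 \<rho> \<Longrightarrow> y \<in> cball x0 \<rho> \<Longrightarrow> norm (p i x - p i y) \<le> \<Lambda> i * dist x y" by metis
  have bd: "\<exists>B\<ge>0. \<forall>x\<in>cball x0 \<rho>. norm (g x) \<le> B" if "continuous_on S g" for g :: "real ^ 3 \<Rightarrow> complex"
  proof -
    have "bounded (g ` cball x0 \<rho>)"
      using that \<rho>S by (intro compact_imp_bounded compact_continuous_image) (auto intro: continuous_on_subset)
    then show ?thesis unfolding bounded_pos by (auto intro: less_imp_le)
  qed
  obtain BF where BF: "\<And>i. BF i \<ge> 0" "\<And>i x. x \<in> cball x0 \<rho> \<Longrightarrow> norm (F i x) \<le> BF i"
    using bd[OF cS(1)] by metis
  have cp: "continuous_on S (p i)" for i unfolding p_def by (intro continuous_intros cS) (use nz in auto)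
  obtain Bp where Bp: "\<And>i. Bp i \<ge> 0" "\<And>i x. x \<in> cball x0 \<rho> \<Longrightarrow> norm (p i x) \<le> Bp i"
    using bd[OF cp] by metis
  define L where "L = 2 * ((\<Sum>i\<in>UNIV. BF i * \<Lambda> i) + (\<Sum>i\<in>UNIV. Bp i))"
  have s0: "0 \<le> (\<Sum>i\<in>UNIV. BF i * \<Lambda> i)" "0 \<le> (\<Sum>i\<in>UNIV. Bp i)"
    using BF(1) \<Lambda>(1) Bp(1) by (auto intro!: sum_nonneg)
  have L0: "L \<ge> 0" using s0 by (simp add: L_def)
  have hp: "h y = - 2 * (\<Sum>i\<in>UNIV. F i y * p i y)" for y
    by (simp add: h_def p_def sum_divide_distrib[symmetric])
  have "norm (h x - h y) \<le> L * (dist x y + (\<Sum>j\<in>UNIV. norm (F j x - F j y)))"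
    if "dist x0 x < \<rho>" "dist x0 y < \<rho>" for x y
  proof -
    have x: "x \<in> cball x0 \<rho>" and y: "y \<in> cball x0 \<rho>" using that by auto
    \<comment> \<open>The product difference is split so that the variation of \<open>p\<close>
      costs a multiple of the distance and the variation of \<open>F\<close> is kept as it
      is.\<close>
    have "h x - h y = - 2 * (\<Sum>i\<in>UNIV. F i x * (p i x - p i y) + (F i x - F i y) * p i y)"
      by (simp add: hp sum_3 algebra_simps)
    then have "norm (h x - h y) = 2 * norm (\<Sum>i\<in>UNIV. F i x * (p i x - p i y) + (F i x - F i y) * p i y)"
      by (simp add: norm_mult)
    also have "norm (\<Sum>i\<in>UNIV. F i x * (p i x - p i y) + (F i x - F i y) * p i y)
       \<le> (\<Sum>i\<in>UNIV. BF i * (\<Lambda> i * dist x y) + norm (F i x - F i y) * Bp i)"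
    proof (rule sum_norm_le)
      fix i
      have "norm (F i x * (p i x - p i y)) \<le> BF i * (\<Lambda> i * dist x y)"
        unfolding norm_mult by (intro mult_mono BF(2)[OF x] \<Lambda>(2)[OF x y] BF(1)) auto
      moreover have "norm ((F i x - F i y) * p i y) \<le> norm (F i x - F i y) * Bp i"
        unfolding norm_mult by (intro mult_left_mono Bp(2)[OF y]) auto
      ultimately show "norm (F i x * (p i x - p i y) + (F i x - F i y) * p i y)
          \<le> BF i * (\<Lambda> i * dist x y) + norm (F i x - F i y) * Bp i"
        by (rule norm_triangle_mono)
    qed
    also have "\<dots> \<le> (\<Sum>i\<in>UNIV. BF i * \<Lambda> i) * dist x y + (\<Sum>i\<in>UNIV. norm (F i x - F i y)) * (\<Sum>i\<in>UNIV. Bp i)"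
    proof -
      have "(\<Sum>i\<in>UNIV. norm (F i x - F i y) * Bp i) \<le> (\<Sum>i\<in>UNIV. norm (F i x - F i y) * (\<Sum>i\<in>UNIV. Bp i))"
        using Bp(1) by (intro sum_mono mult_left_mono member_le_sum) auto
      then show ?thesis by (simp add: sum.distrib sum_distrib_right mult.assoc)
    qed
    also have "2 * \<dots> \<le> L * (dist x y + (\<Sum>j\<in>UNIV. norm (F j x - F j y)))"
    proof -
      let ?N = "\<Sum>j\<in>UNIV. norm (F j x - F j y)"
      have "0 \<le> (\<Sum>i\<in>UNIV. BF i * \<Lambda> i) * ?N" "0 \<le> (\<Sum>i\<in>UNIV. Bp i) * dist x y"
        using s0 by (auto intro!: mult_nonneg_nonneg sum_nonneg)
      then show ?thesis by (simp add: L_def algebra_simps)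
    qed
    finally show ?thesis by simp
  qed
  from gradient_regularity[OF this L0] show ?thesis by (simp add: h_def)
qed

section \<open>Complex quaternions in coordinates\<close>

lemma partial_eq:
  assumes "(G has_derivative G') (at x)" shows "partial i G x = G' (axis i 1)"
proof -
  have "((\<lambda>t::real. x + t *\<^sub>R axis i 1) has_derivative (\<lambda>t. t *\<^sub>R axis i 1)) (at 0)"
    by (auto intro!: derivative_eq_intros)
  from has_derivative_compose[OF this, of G G'] assms
  have "((\<lambda>t. G (x + t *\<^sub>R axis i 1)) has_derivative (\<lambda>t. G' (t *\<^sub>R axis i 1))) (at 0)" by simp
  then have "((\<lambda>t. G (x + t *\<^sub>R axis i 1)) has_vector_derivative G' (axis i 1)) (at 0)"
    by (simp add: has_vector_derivative_def linear_cmul[OF has_derivative_linear[OF assms]])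
  then show ?thesis unfolding partial_def by (rule vector_derivative_at)
qed

lemma partial_eq_of_sum:
  assumes "(G has_derivative (\<lambda>v. \<Sum>i\<in>UNIV. (v $ i) *\<^sub>R A i)) (at x)" shows "partial i G x = A i"
  using partial_eq[OF assms, of i] by (simp add: axis_def if_distrib if_distribR cong: if_cong)

lemma has_derivative_partials:
  assumes "G differentiable (at x)"
  shows "(G has_derivative (\<lambda>v. \<Sum>i\<in>UNIV. (v $ i) *\<^sub>R partial i G x)) (at x)"
proof -
  obtain G' where G': "(G has_derivative G') (at x)" using assms by (auto simp: differentiable_def)
  have "G' v = (\<Sum>i\<in>UNIV. (v $ i) *\<^sub>R partial i G x)" for v
  proof -
    have "(\<Sum>i\<in>UNIV. (v $ i) *\<^sub>R axis i 1) = v"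
      using basis_expansion[of v] by (simp only: scalar_mult_eq_scaleR)
    then have "G' v = G' (\<Sum>i\<in>UNIV. (v $ i) *\<^sub>R axis i 1)" by simp
    also have "\<dots> = (\<Sum>i\<in>UNIV. (v $ i) *\<^sub>R partial i G x)"
      by (simp only: linear_sum[OF has_derivative_linear[OF G']] linear_cmul[OF has_derivative_linear[OF G']] partial_eq[OF G'])
    finally show ?thesis .
  qed
  then have "G' = (\<lambda>v. \<Sum>i\<in>UNIV. (v $ i) *\<^sub>R partial i G x)" by (rule ext)
  then show ?thesis using G' by simp
qed

lemma C_k_on_continuous: "C_k_on n G S \<Longrightarrow> continuous_on S G"
  by (cases n) (simp_all add: continuous_at_imp_continuous_on differentiable_imp_continuous_within)

lemma C_k_on_Suc_has_partials: "C_k_on (Suc n) G S \<Longrightarrow> has_partials_on G (\<lambda>i. partial i G) S"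
  unfolding has_partials_on_def by (auto simp: has_derivative_partials intro: C_k_on_continuous[of n])

lemma has_partials_on_vec_nth:
  fixes G :: "real ^ 3 \<Rightarrow> complex ^ 'n"
  assumes "has_partials_on G P S"
  shows "has_partials_on (\<lambda>x. G x $ k) (\<lambda>i x. P i x $ k) S"
  unfolding has_partials_on_def
proof (intro conjI ballI allI)
  fix x assume x: "x \<in> S"
  show "((\<lambda>x. G x $ k) has_derivative (\<lambda>v. \<Sum>i\<in>UNIV. v $ i *\<^sub>R P i x $ k)) (at x)"
    by (rule has_derivative_eq_rhs[OF bounded_linear.has_derivative[OF bounded_linear_vec_nth has_partials_on_derivative[OF assms x]]])
      simp
next
  fix i show "continuous_on S (\<lambda>x. P i x $ k)"
    by (intro continuous_intros has_partials_on_continuous_partial[OF assms])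
qed

lemma bounded_linear_vector_scalar_mult: "bounded_linear (\<lambda>c::complex. c *s (q :: complex ^ 'n))"
  by (rule linear_conv_bounded_linear[THEN iffD1], rule linearI)
    (simp_all add: vec_eq_iff algebra_simps)

lemma log_D_nth:
  assumes "f differentiable (at x)"
  shows "log_D f x $ 0 = 0" "log_D f x $ 1 = partial 1 f x / f x"
    "log_D f x $ 2 = partial 2 f x / f x" "log_D f x $ 3 = partial 3 f x / f x"
proof -
  have "partial i (\<lambda>y. qscalar (f y)) x = partial i f x *s qunit 0" for i
    unfolding qscalar_def
    by (rule partial_eq_of_sum, rule has_derivative_eq_rhs[OF bounded_linear.has_derivative[OF
          bounded_linear_vector_scalar_mult has_derivative_partials[OF assms]]])
      (simp add: fun_eq_iff sum_3 vec_eq_iff algebra_simps)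
  then show "log_D f x $ 0 = 0" "log_D f x $ 1 = partial 1 f x / f x"
    "log_D f x $ 2 = partial 2 f x / f x" "log_D f x $ 3 = partial 3 f x / f x"
    by (simp_all add: log_D_def D_left_def) (simp_all add: qunit_def axis_def)
qed

lemma qunit_nth: "qunit \<alpha> $ \<beta> = (if \<alpha> = \<beta> then 1 else 0)"
  by (simp add: qunit_def axis_def)

lemma qconj_nth: "qconj Q $ 0 = Q $ 0" "qconj Q $ 1 = - Q $ 1" "qconj Q $ 2 = - Q $ 2" "qconj Q $ 3 = - Q $ 3"
  by (simp_all add: qconj_def)

text \<open>In vector terms: the scalar part is minus the divergence, the vector part is gradient
  plus curl.\<close>

lemma D_left_nth:
  "D_left Q x $ 0 = - (partial 1 Q x $ 1 + partial 2 Q x $ 2 + partial 3 Q x $ 3)"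
  "D_left Q x $ 1 = partial 1 Q x $ 0 + partial 2 Q x $ 3 - partial 3 Q x $ 2"
  "D_left Q x $ 2 = partial 2 Q x $ 0 + partial 3 Q x $ 1 - partial 1 Q x $ 3"
  "D_left Q x $ 3 = partial 3 Q x $ 0 + partial 1 Q x $ 2 - partial 2 Q x $ 1"
  by (simp_all add: D_left_def) (simp_all add: qunit_nth algebra_simps)

text \<open>Compared with \<open>D_left_nth\<close> only the curl changes sign, so the equation for
  \<open>W\<close> can be used to eliminate the curl from the Bers derivative.\<close>

lemma D_right_nth:
  "D_right Q x $ 0 = - (partial 1 Q x $ 1 + partial 2 Q x $ 2 + partial 3 Q x $ 3)"
  "D_right Q x $ 1 = partial 1 Q x $ 0 - partial 2 Q x $ 3 + partial 3 Q x $ 2"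
  "D_right Q x $ 2 = partial 2 Q x $ 0 - partial 3 Q x $ 1 + partial 1 Q x $ 3"
  "D_right Q x $ 3 = partial 3 Q x $ 0 - partial 1 Q x $ 2 + partial 2 Q x $ 1"
  by (simp_all add: D_right_def) (simp_all add: qunit_nth algebra_simps)

section \<open>The Bers derivative as a weighted gradient\<close>

theorem mainTheorem1:
  fixes \<Omega> :: "(real ^ 3) set"
    and q f :: "real ^ 3 \<Rightarrow> complex"
    and W :: "real ^ 3 \<Rightarrow> cquat"
  assumes "open \<Omega>" and "connected \<Omega>" and "\<Omega> \<noteq> {}"
    and "C_k_on 2 f \<Omega>"
    and "\<forall>x\<in>\<Omega>. f x \<noteq> 0"
    and "\<forall>x\<in>\<Omega>. - laplacian f x + q x * f x = 0"
    and "C_k_on 1 W \<Omega>"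
    and "solves_on (V_op f) W \<Omega>"
  shows "solves_on (V1_op f) (Bers_derivative f W) \<Omega>"
proof -
  define f' where "f' i = partial i f" for i
  define w where "w \<alpha> x = W x $ \<alpha>" for \<alpha> x
  define w' where "w' \<alpha> i x = partial i W x $ \<alpha>" for \<alpha> i x
  have f2: "C_k_on (Suc (Suc 0)) f \<Omega>" using assms(4) by (simp add: numeral_2_eq_2)
  have nz: "f x \<noteq> 0" if "x \<in> \<Omega>" for x using assms(5) that by blast
  have fdiff: "f differentiable (at x)" if "x \<in> \<Omega>" for x using f2 that by simp
  have f: "has_partials_on f f' \<Omega>"
    using C_k_on_Suc_has_partials[OF f2] by (simp add: f'_def[abs_def])
  have "C_k_on (Suc 0) (f' i) \<Omega>" for i using f2 by (simp add: f'_def)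
  from C_k_on_Suc_has_partials[OF this]
  have f'': "has_partials_on (f' i) (\<lambda>k. partial k (f' i)) \<Omega>" for i .
  have "has_partials_on W (\<lambda>i. partial i W) \<Omega>"
    by (rule C_k_on_Suc_has_partials[of 0]) (use assms(7) in simp)
  then have w: "has_partials_on (w \<alpha>) (w' \<alpha>) \<Omega>" for \<alpha>
    unfolding w_def[abs_def] w'_def[abs_def] by (rule has_partials_on_vec_nth)
  define u where "u x = w 0 x / f x" for x
  define F where "F i x = w' 0 i x / f x - w 0 x * f' i x / (f x * f x)" for i x
  have u: "has_partials_on u F \<Omega>"
    unfolding u_def[abs_def] F_def[abs_def] by (rule has_partials_on_divide[OF w f nz])
  \<comment> \<open>The first equation is equivalent to \<open>div (f w) = 0\<close>. The others say
    that \<open>f (grad W0 + curl w)\<close> is \<open>W0 grad f\<close> minus the cross product of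
    \<open>grad f\<close> and \<open>w\<close>.\<close>
  have eqs: "- (w' 1 1 x + w' 2 2 x + w' 3 3 x) = (f' 1 x * w 1 x + f' 2 x * w 2 x + f' 3 x * w 3 x) / f x"
    "w' 0 1 x + w' 3 2 x - w' 2 3 x = (f' 1 x * w 0 x - (f' 2 x * w 3 x - f' 3 x * w 2 x)) / f x"
    "w' 0 2 x + w' 1 3 x - w' 3 1 x = (f' 2 x * w 0 x - (f' 3 x * w 1 x - f' 1 x * w 3 x)) / f x"
    "w' 0 3 x + w' 2 1 x - w' 1 2 x = (f' 3 x * w 0 x - (f' 1 x * w 2 x - f' 2 x * w 1 x)) / f x"
    if x: "x \<in> \<Omega>" for x
  proof -
    have "V_op f W x = 0" using assms(8) x by (simp add: solves_on_def)
    then have "D_left W x $ \<alpha> = (log_D f x \<odot> qconj (W x)) $ \<alpha>" for \<alpha>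
      unfolding V_op_def by (metis eq_iff_diff_eq_0)
    from this[of 0] this[of 1] this[of 2] this[of 3]
    show "- (w' 1 1 x + w' 2 2 x + w' 3 3 x) = (f' 1 x * w 1 x + f' 2 x * w 2 x + f' 3 x * w 3 x) / f x"
    "w' 0 1 x + w' 3 2 x - w' 2 3 x = (f' 1 x * w 0 x - (f' 2 x * w 3 x - f' 3 x * w 2 x)) / f x"
    "w' 0 2 x + w' 1 3 x - w' 3 1 x = (f' 2 x * w 0 x - (f' 3 x * w 1 x - f' 1 x * w 3 x)) / f x"
    "w' 0 3 x + w' 2 1 x - w' 1 2 x = (f' 3 x * w 0 x - (f' 1 x * w 2 x - f' 2 x * w 1 x)) / f x"
      unfolding D_left_nth qmult_nth log_D_nth[OF fdiff[OF x]] qconj_nth w_def w'_def f'_def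
      by (simp_all add: add_divide_distrib diff_divide_distrib)
  qed
  \<comment> \<open>\<open>of_nat\<close> converts the index \<open>j :: 3\<close>, where \<open>3 = 0\<close>, into the corresponding index of type \<open>4\<close>.\<close>
  define v where "v j x = f x * w (of_nat (if j = 1 then 1 else if j = 2 then 2 else 3)) x" for j :: 3 and x
  define V where "V j i x = f x * w' (of_nat (if j = 1 then 1 else if j = 2 then 2 else 3)) i x
    + f' i x * w (of_nat (if j = 1 then 1 else if j = 2 then 2 else 3)) x" for j i :: 3 and x
  have v: "has_partials_on (v j) (V j) \<Omega>" for j
    unfolding v_def[abs_def] V_def[abs_def] by (rule has_partials_on_mult[OF f w])
  have V: "V 1 i x = f x * w' 1 i x + f' i x * w 1 x" "V 2 i x = f x * w' 2 i x + f' i x * w 2 x"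
    "V 3 i x = f x * w' 3 i x + f' i x * w 3 x" for i x
    by (simp_all add: V_def)
  have fF: "f x * f x * F i x = f x * w' 0 i x - w 0 x * f' i x" if "x \<in> \<Omega>" for i x
    using nz[OF that] by (simp add: F_def right_diff_distrib)
  \<comment> \<open>The vector part of \<open>eqs\<close> multiplied by \<open>f\<close>:
    \<open>f^2 grad u = - curl (f w)\<close>.\<close>
  have curl: "f x * f x * F 1 x = V 2 3 x - V 3 2 x" "f x * f x * F 2 x = V 3 1 x - V 1 3 x"
    "f x * f x * F 3 x = V 1 2 x - V 2 1 x" if x: "x \<in> \<Omega>" for x
    using eqs(2-4)[OF x] nz[OF x] unfolding fF[OF x] V by (simp_all add: field_simps)
  define B where "B x = (2 * (f x * F 1 x)) *s qunit 1 + (2 * (f x * F 2 x)) *s qunit 2 + (2 * (f x * F 3 x)) *s qunit 3" for x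
  \<comment> \<open>The scalar part vanishes by the first of \<open>eqs\<close>. In the vector part
    the other three eliminate the curl, which doubles \<open>grad W0 - W0 grad f / f\<close>, that
    is, \<open>f grad u\<close>.\<close>
  have Bers: "Bers_derivative f W x = B x" if x: "x \<in> \<Omega>" for x
  proof -
    have fF': "f x * F i x = w' 0 i x - w 0 x * f' i x / f x" for i
      using nz[OF x] by (simp add: F_def right_diff_distrib)
    note log = log_D_nth[OF fdiff[OF x], folded f'_def]
    note e = eqs[OF x, unfolded add_divide_distrib diff_divide_distrib]
    have "Bers_derivative f W x $ 0 = B x $ 0"
      using e(1) by (simp add: Bers_derivative_def D_right_nth log qconj_nth B_def qunit_nth w_def w'_def algebra_simps)
    moreover have "Bers_derivative f W x $ 1 = B x $ 1"
      using e(2) by (simp add: Bers_derivative_def D_right_nth log qconj_nth B_def qunit_nth fF' w_def w'_def algebra_simps)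
    moreover have "Bers_derivative f W x $ 2 = B x $ 2"
      using e(3) by (simp add: Bers_derivative_def D_right_nth log qconj_nth B_def qunit_nth fF' w_def w'_def algebra_simps)
    moreover have "Bers_derivative f W x $ 3 = B x $ 3"
      using e(4) by (simp add: Bers_derivative_def D_right_nth log qconj_nth B_def qunit_nth fF' w_def w'_def algebra_simps)
    ultimately show ?thesis by (simp add: vec_eq_iff forall_index4)
  qed
  show ?thesis
    unfolding solves_on_def
  proof (intro ballI)
    fix x assume x: "x \<in> \<Omega>"
    obtain F' where F': "\<And>j. (F j has_derivative (\<lambda>v. \<Sum>i\<in>UNIV. v $ i *\<^sub>R F' j i)) (at x)"
      and sym: "\<And>i j. F' j i = F' i j"
      and div: "(\<Sum>j\<in>UNIV. F' j j) = - 2 * (\<Sum>i\<in>UNIV. F i x * f' i x) / f x"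
      using weighted_curl_gradient_regularity[OF assms(1) x u f nz f'' v curl] by blast
    \<comment> \<open>With \<open>F'\<close> as the Hessian of \<open>u\<close>, this is the partial
      in direction \<open>i\<close> of component \<open>j\<close> of
      \<open>2 f grad u\<close>.\<close>
    define b where "b j i = 2 * (f x * F' j i + f' i x * F j x)" for j i
    have bder: "((\<lambda>x. (2 * (f x * F j x)) *s qunit \<alpha>) has_derivative (\<lambda>v. \<Sum>i\<in>UNIV. v $ i *\<^sub>R (b j i *s qunit \<alpha>))) (at x)" for j \<alpha>
      by (rule has_derivative_eq_rhs[OF bounded_linear.has_derivative[OF bounded_linear_vector_scalar_mult
          has_derivative_mult_right[OF has_derivative_mult[OF has_partials_on_derivative[OF f x] F']]]])
        (simp add: fun_eq_iff sum_3 vec_eq_iff b_def algebra_simps)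
    have "(B has_derivative (\<lambda>v. \<Sum>i\<in>UNIV. v $ i *\<^sub>R (b 1 i *s qunit 1 + b 2 i *s qunit 2 + b 3 i *s qunit 3))) (at x)"
      unfolding B_def[abs_def]
      by (rule has_derivative_eq_rhs[OF has_derivative_add[OF has_derivative_add[OF bder bder] bder]])
        (simp add: fun_eq_iff scaleR_add_right sum.distrib)
    \<comment> \<open>\<open>B\<close> agrees with the Bers derivative only on \<Omega>, which is
      open, so the derivative at \<open>x\<close> carries over.\<close>
    then have der: "(Bers_derivative f W has_derivative (\<lambda>v. \<Sum>i\<in>UNIV. v $ i *\<^sub>R (b 1 i *s qunit 1 + b 2 i *s qunit 2 + b 3 i *s qunit 3))) (at x)"
      by (rule has_derivative_transform_within_open[OF _ assms(1) x]) (simp add: Bers)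
    have p: "partial i (Bers_derivative f W) x = b 1 i *s qunit 1 + b 2 i *s qunit 2 + b 3 i *s qunit 3" for i
      by (rule partial_eq_of_sum[OF der])
    note log = log_D_nth[OF fdiff[OF x], folded f'_def]
    have "F' 1 1 + F' 2 2 + F' 3 3 = - 2 * (F 1 x * f' 1 x + F 2 x * f' 2 x + F 3 x * f' 3 x) / f x"
      using div by (simp add: sum_3)
    then have div': "f x * F' 1 1 + f x * F' 2 2 + f x * F' 3 3 = - 2 * (F 1 x * f' 1 x + F 2 x * f' 2 x + F 3 x * f' 3 x)"
      using nz[OF x] by (simp add: field_simps)
    \<comment> \<open>Of the coefficient 4, half comes from the divergence of
      \<open>2 f grad u\<close> by the product rule and half from the product with
      \<open>log_D\<close>. By \<open>div'\<close> the remaining divergence term cancels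
      both.\<close>
    have "V1_op f (Bers_derivative f W) x $ 0 = - 2 * (f x * F' 1 1 + f x * F' 2 2 + f x * F' 3 3) - 4 * (F 1 x * f' 1 x + F 2 x * f' 2 x + F 3 x * f' 3 x)"
      using nz[OF x]
      by (simp add: V1_op_def D_right_nth p log Bers[OF x] B_def qunit_nth b_def algebra_simps)
    then have "V1_op f (Bers_derivative f W) x $ 0 = 0" unfolding div' by simp
    \<comment> \<open>By symmetry of the Hessian the curl of \<open>2 f grad u\<close> is twice the
      cross product of \<open>grad f\<close> and \<open>grad u\<close>. \<open>D_right\<close>
      contributes it with a minus sign, and the product with \<open>log_D\<close> contributes the
      same with a plus sign.\<close>
    moreover have "V1_op f (Bers_derivative f W) x $ 1 = 0"
      using nz[OF x] sym[of 2 3]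
      by (simp add: V1_op_def D_right_nth p log Bers[OF x] B_def qunit_nth b_def)
    moreover have "V1_op f (Bers_derivative f W) x $ 2 = 0"
      using nz[OF x] sym[of 1 3]
      by (simp add: V1_op_def D_right_nth p log Bers[OF x] B_def qunit_nth b_def)
    moreover have "V1_op f (Bers_derivative f W) x $ 3 = 0"
      using nz[OF x] sym[of 1 2]
      by (simp add: V1_op_def D_right_nth p log Bers[OF x] B_def qunit_nth b_def)
    ultimately have "V1_op f (Bers_derivative f W) x = 0" by (simp add: vec_eq_iff forall_index4)
    then show "Bers_derivative f W differentiable at x \<and> V1_op f (Bers_derivative f W) x = 0"
      using der by (auto simp: differentiable_def)
  qed
qed

end
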